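(* Let $n\ge 3$ be a prime. Let $m\ge 1$ be an odd integer and $t\ge 2$ an even integer with factorizations $$m=m_0\Big(\prod_{i=1}^{r_1}m_i\Big)\Big(\prod_{i=1}^{q_1}m_i'\Big),\qquad t=t_0\Big(\prod_{i=1}^{r_2}t_i\Big)\Big(\prod_{i=1}^{q_2}t_i'\Big),$$ where $r_1,q_1,r_2,q_2\ge 0$ and $m_0,t_0\ge 1$ are integers, $m_1,\ldots,m_{r_1},t_1,\ldots,t_{r_2}$ are odd primes, and $m_1',\ldots,m_{q_1}',t_1',\ldots,t_{q_2}'\ge 2$ are integers. Suppose that there exist even divisors $d_i$ of $m_i-1$ ($1\le i\le r_1$), even divisors $d_j'$ of $t_j-1$ ($1\le j\le r_2$), an even divisor $a$ of $n-1$, and $\kappa\in\{a,a^2\}$ such that $$\kappa\Big(\prod_{i=1}^{r_1}d_i\Big)\Big(\prod_{j=1}^{r_2}d_j'\Big)\Big(\prod_{i=1}^{q_1}(m_i'-1)\Big)\Big(\prod_{i=1}^{q_2}(t_i'-1)\Big)=mt$$ and $$t+a\Big(\prod_{i=1}^{r_1}d_i\Big)\Big(\prod_{i=1}^{q_1}(m_i'-1)\Big)\ne m+\frac{\kappa}{a}\Big(\prod_{j=1}^{r_2}d_j'\Big)\Big(\prod_{i=1}^{q_2}(t_i'-1)\Big).$$ Then there exists a nut graph with $(o_v,o_e)=(2,3)$ of order $n(m+t)$.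
   Context: A nut graph is a finite simple graph whose adjacency matrix has a one-dimensional null space spanned by a vector with no zero entries. For a graph $\Gamma$, $o_v$ and $o_e$ denote the numbers of orbits of $\mathrm{Aut}(\Gamma)$ on the vertex set and on the edge set of $\Gamma$, respectively. Divisors are positive. Empty products equal $1$. *)

theory Defs
  imports
    "Graph_Theory.Pair_Digraph"
    "Jordan_Normal_Form.Matrix_Kernel"
    "HOL-Algebra.Group_Action"
    "HOL-Computational_Algebra.Primes"
begin

text \<open>
  A finite simple graph is a \<open>pair_graph\<close>: a finite vertex set \<open>pverts G\<close> with a symmetric,
  irreflexive set \<open>parcs G\<close> of ordered pairs. Each undirected edge is thus represented by two
  opposite arcs, and the edge set consists of the two-element sets underlying them.
\<close>

definition edges :: "'a pair_pre_digraph \<Rightarrow> 'a set set" where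
  "edges G = {{u, v} | u v. (u, v) \<in> parcs G}"

text \<open>
  Rows and columns of the adjacency matrix follow the increasing enumeration of the vertices.
  Any other enumeration permutes rows and columns simultaneously, which affects neither the
  nullity nor the presence of zero entries in a null vector.
\<close>

definition adjacency_matrix :: "'a::linorder pair_pre_digraph \<Rightarrow> real mat" where
  "adjacency_matrix G =
     (let vs = sorted_list_of_set (pverts G)
      in mat (length vs) (length vs) (\<lambda>(i, j). if (vs ! i, vs ! j) \<in> parcs G then 1 else 0))"

definition nut_graph :: "'a::linorder pair_pre_digraph \<Rightarrow> bool" where
  "nut_graph G \<longleftrightarrow> pair_graph G \<and>
     kernel_dim (adjacency_matrix G) = 1 \<and>
     (\<exists>x \<in> carrier_vec (card (pverts G)).
        mat_kernel (adjacency_matrix G) =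
          LinearCombinations.module.span class_ring (module_vec TYPE(real) (card (pverts G))) {x} \<and>
        (\<forall>i < card (pverts G). x $ i \<noteq> 0))"

text \<open>\<open>Aut(G)\<close> as a subgroup of the symmetric group on the vertex set; as in \<open>BijGroup\<close>,
  permutations are made unique by being \<open>undefined\<close> off the vertex set.\<close>

definition aut_group :: "'a pair_pre_digraph \<Rightarrow> ('a \<Rightarrow> 'a) monoid" where
  "aut_group G = (BijGroup (pverts G))
     \<lparr>carrier := {f \<in> Bij (pverts G). \<forall>u\<in>pverts G. \<forall>v\<in>pverts G.
                    (f u, f v) \<in> parcs G \<longleftrightarrow> (u, v) \<in> parcs G}\<rparr>"

definition num_vertex_orbits :: "'a pair_pre_digraph \<Rightarrow> nat" where
  "num_vertex_orbits G = card (orbits (aut_group G) (pverts G) (\<lambda>f v. f v))"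

definition num_edge_orbits :: "'a pair_pre_digraph \<Rightarrow> nat" where
  "num_edge_orbits G = card (orbits (aut_group G) (edges G) (\<lambda>f e. f ` e))"

end

theory Submission
  imports Defs
    "HOL-Analysis.Kronecker_Approximation_Theorem"
    "HOL-Number_Theory.Number_Theory"
    "HOL-Combinatorics.Transposition"
    "HOL-Library.Countable"
begin

text \<open>
  Let \<open>A\<close> be the adjacency matrix of the circulant on \<open>\<int>/n\<close> whose connection set is the group of \<open>a\<close>-th
  roots of unity modulo \<open>n\<close>, and let \<open>B\<close> be \<open>A\<close> or the identity according to whether \<open>\<kappa> = a\<^sup>2\<close> or
  \<open>\<kappa> = a\<close>. The graph has the vertex set \<open>\<int>/n \<times> X\<close> together with \<open>\<int>/n \<times> Y\<close>, where \<open>|X| = m\<close> and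
  \<open>|Y| = t\<close>; its adjacency matrix has diagonal blocks \<open>A \<otimes> M\<close> and \<open>B \<otimes> T\<close>, and a vertex \<open>(x, u)\<close> of
  the first kind is joined to all vertices \<open>(x, w)\<close> of the second kind with the same \<open>x\<close>. Here \<open>M\<close> is the
  Kronecker product of the identity of size \<open>m\<^sub>0\<close>, the circulants of prime order \<open>m\<^sub>i\<close> whose
  connection set is the group of \<open>d\<^sub>i\<close>-th roots of unity, and the complete graphs on \<open>m\<^sub>i'\<close> points; it is
  regular of degree \<open>\<mu>\<close>, the product of the \<open>d\<^sub>i\<close> and the \<open>m\<^sub>i' - 1\<close>. The matrix \<open>T\<close>, of degree \<open>\<tau>\<close>,
  is built in the same way from \<open>t\<close>. The balance equation reads \<open>a b \<mu> \<tau> = m t\<close>, with \<open>b\<close> the degree of \<open>B\<close>.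

  Every factor is regular, arc-transitive and nonsingular, and all three properties pass to
  Kronecker products (\<open>block_tensor\<close>). Nonsingularity of the circulants is the arithmetic input: a
  circulant of prime order \<open>p\<close> whose row sum is prime to \<open>p\<close> acts unipotently up to a unit modulo \<open>p\<close>,
  so an integral kernel vector is divisible by every power of \<open>p\<close>; Dirichlet's simultaneous
  approximation passes from real to integral kernel vectors (\<open>real_shift_sums_zero_imp_zero\<close>).

  \<^emph>\<open>Kernel.\<close> Let \<open>g\<close> be a null vector. As all factors are nonsingular and regular, \<open>g\<close> takes a value
  \<open>p x\<close> on all \<open>(x, u)\<close> and a value \<open>q x\<close> on all \<open>(x, w)\<close>, and \<open>\<mu> A p = - t q\<close>, \<open>\<tau> B q = - m p\<close>. By
  the balance equation \<open>B A p = a b p\<close>, so that \<open>p\<close> equals the average of its values at the ends of the walks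
  with a step along \<open>B\<close> and a step along \<open>A\<close>. By the maximum principle \<open>p\<close> is constant: these walks include
  the translation by \<open>2\<close> or by \<open>1\<close>, which generates \<open>\<int>/n\<close> because \<open>n\<close> is odd. Hence the null space is
  spanned by the vector that equals \<open>t\<close> on the first part and \<open>- a \<mu>\<close> on the second.

  \<^emph>\<open>Orbits.\<close> The two parts have different vertex degrees, by the inequality in the hypotheses, so no
  automorphism mixes them. Automorphisms of \<open>A\<close>, \<open>M\<close> and \<open>T\<close> act together on the graph, and
  arc-transitivity of the factors makes each part a vertex orbit, and the edges inside the first part, the edges
  inside the second part and the edges between the parts one orbit each.

  The diagonal block \<open>B \<otimes> T\<close> must have zero diagonal even if \<open>B\<close> is the identity. An arc-transitive regular
  relation with a loop is the identity, of degree 1; if \<open>\<tau> = 1\<close>, a perfect matching on the even number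
  \<open>t\<close> of points has the same degree and replaces \<open>T\<close> (\<open>realizable_loopless\<close>).
\<close>

section \<open>Circulants of prime order are nonsingular\<close>

definition fdiff :: "(int \<Rightarrow> int) \<Rightarrow> int \<Rightarrow> int" where
  "fdiff P x = P (x + 1) - P x"

text \<open>
  Newton's forward difference formula: the shift by \<open>k\<close> is the \<open>k\<close>-th power of the identity plus
  the difference operator.
\<close>

lemma shift_eq_sum_fdiff:
  "P (x + int k) = (\<Sum>j\<le>k. int (k choose j) * (fdiff ^^ j) P x)"
proof (induction k arbitrary: x)
  case 0
  then show ?case by simp
next
  case (Suc k)
  let ?D = "\<lambda>j. (fdiff ^^ j) P x"
  have "P (x + int (Suc k)) = P ((x + 1) + int k)" by (simp add: algebra_simps)
  also have "\<dots> = (\<Sum>j\<le>k. int (k choose j) * (fdiff ^^ j) P (x + 1))" by (rule Suc.IH)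
  also have "\<dots> = (\<Sum>j\<le>k. int (k choose j) * ?D j) + (\<Sum>j\<le>k. int (k choose j) * ?D (Suc j))"
    by (simp add: fdiff_def sum.distrib[symmetric] algebra_simps)
  also have "(\<Sum>j\<le>k. int (k choose j) * ?D j)
      = ?D 0 + (\<Sum>j\<le>k. int (k choose Suc j) * ?D (Suc j))"
    using sum.atMost_Suc_shift[of "\<lambda>j. int (k choose j) * ?D j" k]
    by (simp add: binomial_eq_0)
  also have "\<dots> + (\<Sum>j\<le>k. int (k choose j) * ?D (Suc j))
      = ?D 0 + (\<Sum>j\<le>k. int (Suc k choose Suc j) * ?D (Suc j))"
    by (simp add: sum.distrib distrib_right del: funpow.simps)
  also have "\<dots> = (\<Sum>j\<le>Suc k. int (Suc k choose j) * ?D j)"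
    by (subst sum.atMost_Suc_shift) (simp del: funpow.simps binomial_Suc_Suc)
  finally show ?case .
qed

text \<open>
  On functions of period \<open>p\<close> the difference operator is nilpotent modulo \<open>p\<close>: in Newton's formula
  for the shift by \<open>p\<close>, which is the identity, all inner binomial coefficients vanish modulo \<open>p\<close>.
\<close>

lemma fdiff_power_prime_dvd:
  assumes p: "prime p" and per: "\<And>x. P (x + int p) = P x"
  shows "int p dvd (fdiff ^^ p) P x"
proof -
  have p0: "p > 0" using p by (rule prime_gt_0_nat)
  let ?f = "\<lambda>j. int (p choose j) * (fdiff ^^ j) P x"
  have "P x = sum ?f {..p}"
    using shift_eq_sum_fdiff[of P x p] per[of x] by simp
  also have "{..p} = insert 0 (insert p {0<..<p})" using p0 by auto
  also have "sum ?f \<dots> = P x + ((fdiff ^^ p) P x + sum ?f {0<..<p})"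
    using p0 by simp
  finally have "(fdiff ^^ p) P x = - sum ?f {0<..<p}" by simp
  moreover have "int p dvd sum ?f {0<..<p}"
    by (intro dvd_sum dvd_mult2) (use p dvd_choose_prime in force)
  ultimately show ?thesis by simp
qed

lemma fdiff_power_shift_sum:
  "(fdiff ^^ k) (\<lambda>x. \<Sum>s\<in>S. P (x + s)) x = (\<Sum>s\<in>S. (fdiff ^^ k) P (x + s))"
proof (induction k arbitrary: x)
  case (Suc k)
  then show ?case by (simp add: fdiff_def sum_subtractf algebra_simps)
qed simp

text \<open>
  If \<open>P\<close> were nonzero modulo \<open>p\<close>, its last difference that is nonzero modulo \<open>p\<close> would be a constant.
  Summation over the shifts by \<open>S\<close> commutes with differences and multiplies a constant by \<open>card S\<close>, a
  unit modulo \<open>p\<close>, so that constant would have to vanish.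
\<close>

lemma dvd_of_shift_sums_zero:
  assumes p: "prime p" and per: "\<And>x. P (x + int p) = P x"
    and cop: "coprime (card S) p" and zero: "\<And>x. (\<Sum>s\<in>S. P (x + s)) = 0"
  shows "int p dvd P x"
proof -
  have step: "int p dvd (fdiff ^^ k) P x" if next_dvd: "\<And>x. int p dvd (fdiff ^^ Suc k) P x" for k x
  proof -
    let ?h = "(fdiff ^^ k) P"
    have step_cong: "[?h (y + 1) = ?h y] (mod int p)" for y
      using next_dvd[of y] by (simp add: fdiff_def cong_iff_dvd_diff)
    \<comment> \<open>The next difference vanishes modulo \<open>p\<close>, so this one is constant modulo \<open>p\<close>.\<close>
    have const: "[?h (x + s) = ?h x] (mod int p)" for x s
    proof (induction s rule: int_induct[where k = 0])
      case (step1 i)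
      then show ?case using cong_trans[OF step_cong[of "x + i"]] by (simp add: add.assoc)
    next
      case (step2 i)
      then show ?case using cong_trans[OF cong_sym[OF step_cong[of "x + (i - 1)"]]] by simp
    qed simp
    have "(fdiff ^^ k) (\<lambda>x. 0) x = 0" for x
      by (induction k arbitrary: x) (auto simp: fdiff_def)
    then have "0 = (\<Sum>s\<in>S. ?h (x + s))"
      using fdiff_power_shift_sum[where k = k and P = P and S = S and x = x] by (simp add: zero)
    also have "[\<dots> = (\<Sum>s\<in>S. ?h x)] (mod int p)" by (intro cong_sum const)
    finally have "int p dvd int (card S) * ?h x"
      by (simp add: cong_0_iff cong_sym_eq[of 0])
    moreover have "coprime (int p) (int (card S))"
      using cop by (simp add: coprime_commute)
    ultimately show ?thesis by (simp add: coprime_dvd_mult_right_iff)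
  qed
  have "\<forall>x. int p dvd (fdiff ^^ (p - k)) P x" if "k \<le> p" for k
    using that
  proof (induction k)
    case 0
    then show ?case using fdiff_power_prime_dvd[where P = P, OF p per] by simp
  next
    case (Suc k)
    then have "p - k = Suc (p - Suc k)" by simp
    with Suc step[of "p - Suc k"] show ?case by (metis Suc_leD)
  qed
  from this[of p] show ?thesis by simp
qed

text \<open>
  Infinite descent: a kernel vector is divisible by \<open>p\<close>, and the quotient is a kernel vector again.
\<close>

lemma int_shift_sums_zero_imp_zero:
  assumes p: "prime p" and per: "\<And>x. P (x + int p) = P x"
    and cop: "coprime (card S) p" and zero: "\<And>x. (\<Sum>s\<in>S. P (x + s)) = (0 :: int)"
  shows "P x = 0"
proof (rule ccontr)
  assume nz: "P x \<noteq> 0"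
  have p0: "int p \<noteq> 0" using prime_gt_0_nat[OF p] by simp
  have dvd: "int p ^ k dvd Q x"
    if "\<And>x. Q (x + int p) = Q x" "\<And>x. (\<Sum>s\<in>S. Q (x + s)) = 0" for k Q
    using that
  proof (induction k arbitrary: Q)
    case (Suc k)
    have Q: "Q y = int p * (Q y div int p)" for y
      using dvd_of_shift_sums_zero[OF p Suc.prems(1) cop Suc.prems(2)] by simp
    have "int p * (\<Sum>s\<in>S. Q (y + s) div int p) = 0" for y
      unfolding sum_distrib_left Q[symmetric] by (rule Suc.prems)
    then have "int p ^ k dvd Q x div int p"
      using p0 Suc.prems(1) by (intro Suc.IH) auto
    then show ?case by (subst Q) simp
  qed simp
  have "int p ^ nat \<bar>P x\<bar> \<le> \<bar>P x\<bar>"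
    using dvd[OF per zero] nz by (metis abs_ge_self dvd_abs_iff dvd_imp_le_int abs_of_nonneg zero_le_power of_nat_0_le_iff)
  moreover have "\<bar>P x\<bar> < 2 ^ nat \<bar>P x\<bar>"
    using of_nat_less_two_power[of "nat \<bar>P x\<bar>", where ?'a = int] by simp
  moreover have "(2::int) ^ nat \<bar>P x\<bar> \<le> int p ^ nat \<bar>P x\<bar>"
    using prime_ge_2_nat[OF p] by (intro power_mono) auto
  ultimately show False by linarith
qed

text \<open>
  The operator has integer entries. Scale a real kernel vector so that one entry is \<open>1\<close>, multiply it by a
  positive integer \<open>q\<close> that brings all entries within \<open>1 / (card S + 1)\<close> of integers, and round. The shift
  sums of the rounded vector are integers of absolute value below 1, hence zero, and its entry at the chosen
  place is not zero.
\<close>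

lemma real_shift_sums_zero_imp_zero:
  fixes g :: "int \<Rightarrow> real"
  assumes p: "prime p" and per: "\<And>x. g (x + int p) = g x"
    and cop: "coprime (card S) p" and zero: "\<And>x. (\<Sum>s\<in>S. g (x + s)) = 0"
  shows "g x = 0"
proof (rule ccontr)
  assume nz: "g x \<noteq> 0"
  have p0: "int p > 0" using prime_gt_0_nat[OF p] by simp
  have per_mult: "g (y + k * int p) = g y" for y k
  proof (induction k rule: int_induct[where k = 0])
    case (step1 i)
    then show ?case using per[of "y + i * int p"] by (simp add: algebra_simps)
  next
    case (step2 i)
    then show ?case using per[of "y + (i - 1) * int p"] by (simp add: algebra_simps)
  qed simp
  have g_mod: "g (y mod int p) = g y" for y
    using per_mult[of "y mod int p" "y div int p"] by (simp add: algebra_simps)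
  obtain q :: int and P' :: "nat \<Rightarrow> int" where "0 < q"
    and approx: "\<And>i. i < p \<Longrightarrow>
      \<bar>of_int q * (g (int i) / g x) - of_int (P' i)\<bar> < 1 / real (Suc (card S))"
    using Dirichlet_approx_simult[of "Suc (card S)" p "\<lambda>i. g (int i) / g x"] by blast
  \<comment> \<open>The approximation only concerns one period; \<open>P\<close> is its periodic extension.\<close>
  define P where "P = (\<lambda>y. P' (nat (y mod int p)))"
  have close: "\<bar>of_int q * (g y / g x) - of_int (P y)\<bar> < 1 / real (Suc (card S))" for y
    using approx[of "nat (y mod int p)"] p0 by (simp add: P_def g_mod nat_less_iff)
  have "P y = 0" for y
  proof (rule int_shift_sums_zero_imp_zero[where P = P and S = S, OF p _ cop])
    show "P (y + int p) = P y" for y by (simp add: P_def)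
    show "(\<Sum>s\<in>S. P (y + s)) = 0" for y
    proof -
      have "(\<Sum>s\<in>S. of_int q * (g (y + s) / g x)) = 0"
        by (simp add: sum_distrib_left[symmetric] sum_divide_distrib[symmetric] zero)
      then have "\<bar>of_int (\<Sum>s\<in>S. P (y + s))\<bar>
          = \<bar>\<Sum>s\<in>S. of_int q * (g (y + s) / g x) - of_int (P (y + s))\<bar>"
        by (simp add: sum_subtractf)
      also have "\<dots> \<le> (\<Sum>s\<in>S. 1 / real (Suc (card S)))"
        using close by (intro order.trans[OF sum_abs] sum_mono) (simp add: less_imp_le)
      also have "\<dots> < 1" by simp
      finally have "real_of_int \<bar>\<Sum>s\<in>S. P (y + s)\<bar> < 1" by simp
      then show ?thesis by linarith
    qed
  qed
  with close[of x] nz have "\<bar>real_of_int q\<bar> < 1 / real (Suc (card S))" by simp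
  also have "\<dots> \<le> 1" by simp
  finally show False using \<open>0 < q\<close> by simp
qed

section \<open>Regular, arc-transitive, nonsingular relations\<close>

definition relation_aut :: "'a set \<Rightarrow> ('a \<times> 'a) set \<Rightarrow> ('a \<Rightarrow> 'a) set" where
  "relation_aut X R =
     {f. bij_betw f X X \<and> (\<forall>x\<in>X. \<forall>y\<in>X. (f x, f y) \<in> R \<longleftrightarrow> (x, y) \<in> R)}"

text \<open>
  Transitivity on a subset \<open>S\<close> of the arcs, under automorphisms of the whole relation \<open>R\<close>. For
  \<open>S = R\<close> this is the usual notion; proper subsets describe the arc orbits of the final graph.
\<close>

definition arc_transitive :: "'a set \<Rightarrow> ('a \<times> 'a) set \<Rightarrow> ('a \<times> 'a) set \<Rightarrow> bool" where
  "arc_transitive X R S \<longleftrightarrow>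
     (\<forall>u v u' v'. (u, v) \<in> S \<longrightarrow> (u', v') \<in> S \<longrightarrow>
        (\<exists>f\<in>relation_aut X R. f u = u' \<and> f v = v'))"

definition nonsingular :: "'a set \<Rightarrow> ('a \<times> 'a) set \<Rightarrow> bool" where
  "nonsingular X R \<longleftrightarrow>
     (\<forall>g :: 'a \<Rightarrow> real. (\<forall>x\<in>X. (\<Sum>y\<in>R `` {x}. g y) = 0) \<longrightarrow> (\<forall>x\<in>X. g x = 0))"

text \<open>
  The class of Kronecker factors. Loops are permitted, so that the identity belongs to it.
\<close>

definition block :: "'a set \<Rightarrow> ('a \<times> 'a) set \<Rightarrow> nat \<Rightarrow> bool" where
  "block X R d \<longleftrightarrow> finite X \<and> R \<subseteq> X \<times> X \<and> sym R \<and> d > 0 \<and>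
     (\<forall>x\<in>X. card (R `` {x}) = d) \<and> arc_transitive X R R \<and> nonsingular X R"

text \<open>
  The relation whose adjacency matrix is the Kronecker product.
\<close>

definition tensor :: "('a \<times> 'a) set \<Rightarrow> ('b \<times> 'b) set \<Rightarrow> (('a \<times> 'b) \<times> ('a \<times> 'b)) set" where
  "tensor R S = {((x, y), (x', y')) | x y x' y'. (x, x') \<in> R \<and> (y, y') \<in> S}"

lemma relation_autI:
  assumes "bij_betw f X X" "\<And>x y. x \<in> X \<Longrightarrow> y \<in> X \<Longrightarrow> (f x, f y) \<in> R \<longleftrightarrow> (x, y) \<in> R"
  shows "f \<in> relation_aut X R"
  using assms by (simp add: relation_aut_def)

lemma relation_aut_bij: "f \<in> relation_aut X R \<Longrightarrow> bij_betw f X X"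
  by (simp add: relation_aut_def)

lemma relation_aut_iff:
  "f \<in> relation_aut X R \<Longrightarrow> x \<in> X \<Longrightarrow> y \<in> X \<Longrightarrow> (f x, f y) \<in> R \<longleftrightarrow> (x, y) \<in> R"
  by (simp add: relation_aut_def)

lemma relation_aut_closed: "f \<in> relation_aut X R \<Longrightarrow> x \<in> X \<Longrightarrow> f x \<in> X"
  using bij_betwE[OF relation_aut_bij] by blast

lemma relation_aut_image_nbrs:
  assumes f: "f \<in> relation_aut X R" and R: "R \<subseteq> X \<times> X" and x: "x \<in> X"
  shows "R `` {f x} = f ` (R `` {x})"
proof (intro equalityI subsetI)
  fix z assume z: "z \<in> R `` {f x}"
  with R relation_aut_bij[OF f] obtain y where "y \<in> X" "z = f y"
    unfolding bij_betw_def by auto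
  with z relation_aut_iff[OF f x] show "z \<in> f ` (R `` {x})" by auto
next
  fix z assume "z \<in> f ` (R `` {x})"
  with R relation_aut_iff[OF f x] show "z \<in> R `` {f x}" by auto
qed

lemma relation_aut_card_nbrs:
  assumes f: "f \<in> relation_aut X R" and R: "R \<subseteq> X \<times> X" and x: "x \<in> X"
  shows "card (R `` {f x}) = card (R `` {x})"
proof -
  have "R `` {x} \<subseteq> X" using R by auto
  then have "inj_on f (R `` {x})"
    using relation_aut_bij[OF f] by (auto simp: bij_betw_def intro: inj_on_subset)
  then show ?thesis by (simp add: relation_aut_image_nbrs[OF assms] card_image)
qed

lemma mem_map_prod_image_iff:
  assumes "inj e"
  shows "(e u, e v) \<in> map_prod e e ` R \<longleftrightarrow> (u, v) \<in> R"
  using inj_image_mem_iff[OF prod.inj_map[OF assms assms], of "(u, v)" R] by simp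

text \<open>
  Relations on arbitrary countable types are transported into the natural numbers along an injection \<open>e\<close>.
\<close>

lemma relation_aut_image:
  assumes e: "inj e" and R: "R \<subseteq> X \<times> X" and f: "f \<in> relation_aut X R"
  shows "e \<circ> f \<circ> inv_into UNIV e \<in> relation_aut (e ` X) (map_prod e e ` R)"
proof (rule relation_autI)
  show "bij_betw (e \<circ> f \<circ> inv_into UNIV e) (e ` X) (e ` X)"
  proof (intro bij_betw_trans)
    show "bij_betw (inv_into UNIV e) (e ` X) X"
      using e by (simp add: bij_betw_def image_image inj_on_def)
    show "bij_betw f X X" by (rule relation_aut_bij[OF f])
    show "bij_betw e X (e ` X)" using e by (simp add: bij_betw_def inj_on_def)
  qed
next
  fix x y assume "x \<in> e ` X" "y \<in> e ` X"
  then obtain u v where "u \<in> X" "v \<in> X" "x = e u" "y = e v" by auto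
  then show "((e \<circ> f \<circ> inv_into UNIV e) x, (e \<circ> f \<circ> inv_into UNIV e) y) \<in> map_prod e e ` R
      \<longleftrightarrow> (x, y) \<in> map_prod e e ` R"
    using relation_aut_iff[OF f, of u v] by (simp add: mem_map_prod_image_iff[OF e] e)
qed

lemma arc_transitive_image:
  assumes e: "inj e" and R: "R \<subseteq> X \<times> X" and "arc_transitive X R S"
  shows "arc_transitive (e ` X) (map_prod e e ` R) (map_prod e e ` S)"
  unfolding arc_transitive_def
proof (intro allI impI)
  fix a b a' b' assume "(a, b) \<in> map_prod e e ` S" "(a', b') \<in> map_prod e e ` S"
  then obtain u v u' v' where uv: "(u, v) \<in> S" "(u', v') \<in> S"
    "a = e u" "b = e v" "a' = e u'" "b' = e v'" by auto
  then obtain f where "f \<in> relation_aut X R" "f u = u'" "f v = v'"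
    using assms(3) unfolding arc_transitive_def by blast
  then show "\<exists>f\<in>relation_aut (e ` X) (map_prod e e ` R). f a = a' \<and> f b = b'"
    using uv e by (intro bexI[of _ "e \<circ> f \<circ> inv_into UNIV e"] relation_aut_image[OF e R]) auto
qed

lemma image_nbrs:
  assumes e: "inj e"
  shows "(map_prod e e ` R) `` {e x} = e ` (R `` {x})"
  using e by (auto simp: inj_def image_iff)

lemma nonsingular_image:
  assumes e: "inj e" and ns: "nonsingular X R"
  shows "nonsingular (e ` X) (map_prod e e ` R)"
  unfolding nonsingular_def
proof (intro allI impI)
  fix g :: "_ \<Rightarrow> real" assume g: "\<forall>x\<in>e ` X. (\<Sum>y\<in>(map_prod e e ` R) `` {x}. g y) = 0"
  have "inj_on e A" for A using e by (simp add: inj_on_def)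
  then have "(\<Sum>y\<in>R `` {x}. (g \<circ> e) y) = 0" if "x \<in> X" for x
    using g that by (auto simp: image_nbrs[OF e] sum.reindex)
  then have "\<forall>x\<in>X. (g \<circ> e) x = 0"
    using ns[unfolded nonsingular_def, rule_format, of "g \<circ> e"] by blast
  then show "\<forall>x\<in>e ` X. g x = 0" by simp
qed

lemma block_image:
  assumes e: "inj e" and "block X R d"
  shows "block (e ` X) (map_prod e e ` R) d"
proof -
  have "inj_on e A" for A using e by (simp add: inj_on_def)
  then show ?thesis
    using assms arc_transitive_image[OF e, of R X R] nonsingular_image[OF e, of X R]
    by (auto simp: block_def sym_def image_nbrs card_image)
qed

lemma tensor_nbrs: "tensor R S `` {(x, y)} = R `` {x} \<times> S `` {y}"
  by (auto simp: tensor_def)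

lemma relation_aut_tensor:
  assumes "f \<in> relation_aut X R" "g \<in> relation_aut Y S"
  shows "map_prod f g \<in> relation_aut (X \<times> Y) (tensor R S)"
  using assms unfolding relation_aut_def
  by (auto intro: bij_betw_map_prod simp: tensor_def)

text \<open>
  Nonsingularity: for a fixed \<open>y\<close>, the partial sums over \<open>S `` {y}\<close> form a null vector of \<open>R\<close>, hence
  they vanish; for a fixed \<open>x\<close> this says that \<open>g (x, _)\<close> is a null vector of \<open>S\<close>.
\<close>

lemma block_tensor:
  assumes X: "block X R d" and Y: "block Y S d'"
  shows "block (X \<times> Y) (tensor R S) (d * d')"
proof -
  have "arc_transitive (X \<times> Y) (tensor R S) (tensor R S)"
    unfolding arc_transitive_def
  proof (intro allI impI)
    fix a b a' b' assume "(a, b) \<in> tensor R S" "(a', b') \<in> tensor R S"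
    then obtain x y z w x' y' z' w' where
      *: "a = (x, y)" "b = (z, w)" "(x, z) \<in> R" "(y, w) \<in> S"
         "a' = (x', y')" "b' = (z', w')" "(x', z') \<in> R" "(y', w') \<in> S"
      by (auto simp: tensor_def)
    then obtain f g where "f \<in> relation_aut X R" "f x = x'" "f z = z'"
      "g \<in> relation_aut Y S" "g y = y'" "g w = w'"
      using X Y unfolding block_def arc_transitive_def by metis
    with * show "\<exists>f\<in>relation_aut (X \<times> Y) (tensor R S). f a = a' \<and> f b = b'"
      by (intro bexI[of _ "map_prod f g"] relation_aut_tensor) auto
  qed
  moreover have "nonsingular (X \<times> Y) (tensor R S)"
    unfolding nonsingular_def
  proof (intro allI impI ballI)
    fix g :: "'a \<times> 'b \<Rightarrow> real" and z
    assume g: "\<forall>z\<in>X \<times> Y. (\<Sum>w\<in>tensor R S `` {z}. g w) = 0" and "z \<in> X \<times> Y"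
    then obtain x y where z: "z = (x, y)" "x \<in> X" "y \<in> Y" by auto
    have "(\<Sum>x'\<in>R `` {x}. \<Sum>y'\<in>S `` {y}. g (x', y')) = 0" if "x \<in> X" "y \<in> Y" for x y
      using g[rule_format, of "(x, y)"] that by (simp add: tensor_nbrs sum.cartesian_product)
    then have "(\<Sum>y'\<in>S `` {y}. g (x, y')) = 0" if "x \<in> X" "y \<in> Y" for x y
      using X[unfolded block_def nonsingular_def] that by blast
    then show "g z = 0"
      using Y[unfolded block_def nonsingular_def] z by blast
  qed
  ultimately show ?thesis
    using X Y by (auto simp: block_def tensor_nbrs card_cartesian_product)
      (auto simp: tensor_def sym_def)
qed

lemma block_Id: "finite X \<Longrightarrow> block X (Id_on X) 1"
proof -
  assume X: "finite X"
  have nb: "Id_on X `` {x} = {x}" if "x \<in> X" for x using that by auto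
  have "arc_transitive X (Id_on X) (Id_on X)"
    unfolding arc_transitive_def
  proof (intro allI impI)
    fix u v u' v' assume "(u, v) \<in> Id_on X" "(u', v') \<in> Id_on X"
    then have *: "u = v" "u' = v'" "u \<in> X" "u' \<in> X" by auto
    then have "bij_betw (Transposition.transpose u u') X X" by (simp add: bij_betw_transpose_iff)
    moreover have "(Transposition.transpose u u' x, Transposition.transpose u u' y) \<in> Id_on X \<longleftrightarrow> (x, y) \<in> Id_on X"
      if "x \<in> X" "y \<in> X" for x y
      using that * by (auto simp: Transposition.transpose_def Id_on_iff)
    ultimately have "Transposition.transpose u u' \<in> relation_aut X (Id_on X)"
      by (intro relation_autI) auto
    with * show "\<exists>f\<in>relation_aut X (Id_on X). f u = u' \<and> f v = v'"
      by (intro bexI[of _ "Transposition.transpose u u'"]) auto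
  qed
  with X nb show ?thesis
    by (auto simp: block_def nonsingular_def sym_def)
qed

definition complete_rel :: "'a set \<Rightarrow> ('a \<times> 'a) set" where
  "complete_rel X = {(x, y). x \<in> X \<and> y \<in> X \<and> x \<noteq> y}"

lemma block_complete:
  assumes X: "finite X" "card X \<ge> 2"
  shows "block X (complete_rel X) (card X - 1)"
proof -
  have nb: "complete_rel X `` {x} = X - {x}" if "x \<in> X" for x
    using that by (auto simp: complete_rel_def)
  have "arc_transitive X (complete_rel X) (complete_rel X)"
    unfolding arc_transitive_def
  proof (intro allI impI)
    fix u v u' v' assume uv: "(u, v) \<in> complete_rel X" "(u', v') \<in> complete_rel X"
    define w where "w = Transposition.transpose u u' v"
    \<comment> \<open>The first transposition takes \<open>u\<close> to \<open>u'\<close> and \<open>v\<close> to \<open>w\<close>; the second then corrects \<open>w\<close> without moving \<open>u'\<close>.\<close>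
    define f where "f = Transposition.transpose w v' \<circ> Transposition.transpose u u'"
    have "w \<in> X" using uv by (auto simp: w_def Transposition.transpose_def complete_rel_def)
    then have f: "bij_betw f X X"
      using uv unfolding f_def complete_rel_def
      by (intro bij_betw_trans[of _ X X]) (auto simp: bij_betw_transpose_iff)
    then have "f \<in> relation_aut X (complete_rel X)"
      by (intro relation_autI) (auto simp: complete_rel_def bij_betw_def inj_on_def)
    moreover have "w \<noteq> u'" using uv by (auto simp: w_def Transposition.transpose_def complete_rel_def)
    then have "f u = u'" using uv by (auto simp: f_def complete_rel_def)
    moreover have "f v = v'" by (simp add: f_def w_def)
    ultimately show "\<exists>f\<in>relation_aut X (complete_rel X). f u = u' \<and> f v = v'" by blast
  qed
  moreover have "nonsingular X (complete_rel X)"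
    unfolding nonsingular_def
  proof (intro allI impI ballI)
    fix g :: "'a \<Rightarrow> real" and x
    assume zero: "\<forall>x\<in>X. sum g (complete_rel X `` {x}) = 0" and x: "x \<in> X"
    have g: "g y = sum g X" if "y \<in> X" for y
      using bspec[OF zero that] sum.remove[OF X(1) that, of g] by (simp add: nb[OF that])
    have "sum g X = (\<Sum>y\<in>X. sum g X)" by (rule sum.cong[OF refl g])
    then have "sum g X = real (card X) * sum g X" by simp
    then have "sum g X = 0" using X by auto
    with g x show "g x = 0" by simp
  qed
  ultimately show ?thesis
    using X by (auto simp: block_def nb) (auto simp: complete_rel_def sym_def)
qed

section \<open>Circulants of power residues\<close>

text \<open>
  The Cayley graph of \<open>\<int>/p\<close> with respect to the \<open>d\<close>-th roots of unity, a generalised Paley graph.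
  Membership in the connection set is expressed by the congruence, which makes it visibly
  invariant under multiplication by roots of unity.
\<close>

definition power_residue_rel :: "nat \<Rightarrow> nat \<Rightarrow> (int \<times> int) set" where
  "power_residue_rel p d =
     {(x, y). x \<in> {0..<int p} \<and> y \<in> {0..<int p} \<and> [(y - x) ^ d = 1] (mod int p)}"

definition roots_of_unity :: "nat \<Rightarrow> nat \<Rightarrow> int set" where
  "roots_of_unity p d = {s \<in> {0..<int p}. [s ^ d = 1] (mod int p)}"

text \<open>
  The roots of unity are the powers of an element of order \<open>d\<close>, which exists since the group of units
  modulo a prime is cyclic.
\<close>

lemma card_roots_of_unity:
  assumes p: "prime p" and d: "d \<ge> 2" "d dvd p - 1"
  shows "card (roots_of_unity p d) = d"
proof -
  have p1: "p > 1" using prime_gt_1_nat[OF p] .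
  have d0: "d > 0" using d by simp
  have "card {x \<in> totatives p. ord p x = d} = totient d"
    using prime_card_elements_with_ord_eq_totient[of p d] p p1 d
    by simp
  moreover have "totient d > 0" using d0 by simp
  ultimately have ne: "card {x \<in> totatives p. ord p x = d} \<noteq> 0" by simp
  then obtain a where a: "a \<in> totatives p" "ord p a = d"
    by (metis (mono_tags, lifting) card.empty empty_Collect_eq)
  moreover have "a \<noteq> 1" using a d by auto
  ultimately have "inj_on (\<lambda>k. a ^ k mod p) {..<d}"
    "{x\<in>{..<p}. [x ^ d = 1] (mod p)} = (\<lambda>k. a ^ k mod p) ` {..<d}"
    using prime_elements_with_ord[of p d a] p p1 ne by auto
  then have "card {x\<in>{..<p}. [x ^ d = 1] (mod p)} = d" by (simp add: card_image)
  moreover have "roots_of_unity p d = int ` {x\<in>{..<p}. [x ^ d = 1] (mod p)}"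
  proof (intro equalityI subsetI)
    fix s assume s: "s \<in> roots_of_unity p d"
    then have "s = int (nat s)" "nat s < p" by (auto simp: roots_of_unity_def)
    moreover have "[nat s ^ d = 1] (mod p)"
      using s cong_int_iff[of "nat s ^ d" 1 p] by (auto simp: roots_of_unity_def)
    ultimately show "s \<in> int ` {x\<in>{..<p}. [x ^ d = 1] (mod p)}" by blast
  next
    fix s assume "s \<in> int ` {x\<in>{..<p}. [x ^ d = 1] (mod p)}"
    then show "s \<in> roots_of_unity p d"
      using cong_int_iff[of "nat s ^ d" 1 p] by (auto simp: roots_of_unity_def)
  qed
  ultimately show ?thesis by (simp add: card_image)
qed

lemma cong_power_1_mod:
  "[(x mod int p - y mod int p) ^ d = 1] (mod int p) \<longleftrightarrow> [(x - y) ^ d = 1] (mod int p)"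
  by (intro iffI; erule cong_trans[rotated]; intro cong_pow cong_diff) (auto simp: cong_def)

lemma power_residue_nbrs:
  assumes p: "prime p" and x: "x \<in> {0..<int p}"
  shows "power_residue_rel p d `` {x} = (\<lambda>s. (x + s) mod int p) ` roots_of_unity p d"
    and "inj_on (\<lambda>s. (x + s) mod int p) (roots_of_unity p d)"
proof -
  have p0: "int p > 0" using prime_gt_0_nat[OF p] by simp
  show "power_residue_rel p d `` {x} = (\<lambda>s. (x + s) mod int p) ` roots_of_unity p d"
  proof (intro equalityI subsetI)
    fix y assume "y \<in> power_residue_rel p d `` {x}"
    then have y: "y \<in> {0..<int p}" "[(y - x) ^ d = 1] (mod int p)"
      by (auto simp: power_residue_rel_def)
    moreover have "y = (x + (y - x) mod int p) mod int p"
      using y by (simp add: mod_simps)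
    moreover have "(y - x) mod int p \<in> roots_of_unity p d"
      using y p0 cong_power_1_mod[of "y - x" p 0 d] by (auto simp: roots_of_unity_def)
    ultimately show "y \<in> (\<lambda>s. (x + s) mod int p) ` roots_of_unity p d" by blast
  next
    fix y assume "y \<in> (\<lambda>s. (x + s) mod int p) ` roots_of_unity p d"
    then obtain s where "s \<in> roots_of_unity p d" "y = (x + s) mod int p" by auto
    then show "y \<in> power_residue_rel p d `` {x}"
      using x p0 cong_power_1_mod[of "x + s" p x d]
      by (auto simp: power_residue_rel_def roots_of_unity_def)
  qed
  show "inj_on (\<lambda>s. (x + s) mod int p) (roots_of_unity p d)"
  proof (rule inj_onI)
    fix s s' assume s: "s \<in> roots_of_unity p d" "s' \<in> roots_of_unity p d"
      and "(x + s) mod int p = (x + s') mod int p"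
    then have "[s = s'] (mod int p)"
      using cong_add_lcancel[of x s s' "int p"] by (simp add: cong_def)
    then show "s = s'" using s by (auto simp: roots_of_unity_def cong_def)
  qed
qed

lemma bij_betw_affine_mod:
  assumes p: "p > 0" and al: "coprime \<alpha> (int p)"
  shows "bij_betw (\<lambda>z. (\<alpha> * z + \<beta>) mod int p) {0..<int p} {0..<int p}"
proof -
  have "inj_on (\<lambda>z. (\<alpha> * z + \<beta>) mod int p) {0..<int p}"
  proof (rule inj_onI)
    fix z w assume zw: "z \<in> {0..<int p}" "w \<in> {0..<int p}"
      and "(\<alpha> * z + \<beta>) mod int p = (\<alpha> * w + \<beta>) mod int p"
    then have "[\<alpha> * z = \<alpha> * w] (mod int p)"
      using cong_add_rcancel[of "\<alpha> * z" \<beta> "\<alpha> * w" "int p"] by (simp add: cong_def)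
    then have "[z = w] (mod int p)"
      using al by (simp add: cong_mult_lcancel)
    then show "z = w" using zw by (simp add: cong_def)
  qed
  then show ?thesis
    using p endo_inj_surj[of "{0..<int p}"] by (auto simp: bij_betw_def image_subset_iff)
qed

lemma power_residue_affine_aut:
  assumes p: "prime p" and d: "d > 0" and al: "[\<alpha> ^ d = 1] (mod int p)"
  shows "(\<lambda>z. (\<alpha> * z + \<beta>) mod int p) \<in> relation_aut {0..<int p} (power_residue_rel p d)"
proof (rule relation_autI)
  have p0: "p > 0" using prime_gt_0_nat[OF p] .
  have "coprime (\<alpha> ^ d) (int p)" using cong_imp_coprime[OF cong_sym[OF al]] by simp
  then have "coprime \<alpha> (int p)" using d by simp
  with p0 show "bij_betw (\<lambda>z. (\<alpha> * z + \<beta>) mod int p) {0..<int p} {0..<int p}"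
    by (rule bij_betw_affine_mod)
  fix x y assume xy: "x \<in> {0..<int p}" "y \<in> {0..<int p}"
  have "[(\<alpha> * y + \<beta> - (\<alpha> * x + \<beta>)) ^ d = (y - x) ^ d] (mod int p)"
    using cong_mult[OF al cong_refl[of "(y - x) ^ d"]]
    by (simp add: power_mult_distrib[symmetric] right_diff_distrib)
  then have "[(\<alpha> * y + \<beta> - (\<alpha> * x + \<beta>)) ^ d = 1] (mod int p) \<longleftrightarrow> [(y - x) ^ d = 1] (mod int p)"
    by (meson cong_trans cong_sym)
  then show "((\<alpha> * x + \<beta>) mod int p, (\<alpha> * y + \<beta>) mod int p) \<in> power_residue_rel p d
      \<longleftrightarrow> (x, y) \<in> power_residue_rel p d"
    using xy p0 by (simp add: power_residue_rel_def cong_power_1_mod)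
qed

text \<open>
  The affine map with multiplier \<open>(v' - u') / (v - u)\<close>; as \<open>v - u\<close> is a \<open>d\<close>-th root of unity, its inverse is
  \<open>(v - u) ^ (d - 1)\<close>.
\<close>

lemma arc_transitive_power_residue:
  assumes p: "prime p" and d: "d > 0"
  shows "arc_transitive {0..<int p} (power_residue_rel p d) (power_residue_rel p d)"
  unfolding arc_transitive_def
proof (intro allI impI)
  fix u v u' v' assume uv: "(u, v) \<in> power_residue_rel p d" "(u', v') \<in> power_residue_rel p d"
  define \<alpha> where "\<alpha> = (v' - u') * (v - u) ^ (d - 1)"
  let ?f = "\<lambda>z. (\<alpha> * z + (u' - \<alpha> * u)) mod int p"
  have pow: "[(v - u) ^ d = 1] (mod int p)" "[(v' - u') ^ d = 1] (mod int p)"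
    using uv by (auto simp: power_residue_rel_def)
  have "\<alpha> ^ d = (v' - u') ^ d * ((v - u) ^ d) ^ (d - 1)"
    by (simp add: \<alpha>_def power_mult_distrib power_mult[symmetric] mult.commute)
  moreover have "[(v' - u') ^ d * ((v - u) ^ d) ^ (d - 1) = 1 * 1 ^ (d - 1)] (mod int p)"
    by (intro cong_mult cong_pow pow)
  ultimately have al: "[\<alpha> ^ d = 1] (mod int p)" by simp
  have "\<alpha> * (v - u) = (v' - u') * (v - u) ^ d"
    using d by (simp add: \<alpha>_def power_eq_if mult_ac)
  moreover have "[(v' - u') * (v - u) ^ d = (v' - u') * 1] (mod int p)"
    by (intro cong_mult cong_refl pow)
  ultimately have "[\<alpha> * (v - u) + u' = (v' - u') + u'] (mod int p)"
    by (intro cong_add cong_refl) simp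
  then have "?f v = v'"
    using uv by (auto simp: cong_def power_residue_rel_def algebra_simps)
  moreover have "?f u = u'" using uv by (auto simp: power_residue_rel_def)
  ultimately show "\<exists>f\<in>relation_aut {0..<int p} (power_residue_rel p d). f u = u' \<and> f v = v'"
    using power_residue_affine_aut[OF p d al] by (intro bexI[of _ ?f]) auto
qed

lemma sum_power_residue_nbrs:
  assumes p: "prime p" and x: "x \<in> {0..<int p}"
  shows "(\<Sum>y\<in>power_residue_rel p d `` {x}. g y) = (\<Sum>s\<in>roots_of_unity p d. g ((x + s) mod int p))"
  using power_residue_nbrs[OF p x, of d] by (simp add: sum.reindex)

text \<open>
  The row sum \<open>d\<close> satisfies \<open>0 < d < p\<close> and is therefore prime to \<open>p\<close>.
\<close>

lemma nonsingular_power_residue: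
  assumes p: "prime p" and d: "d \<ge> 2" "d dvd p - 1"
  shows "nonsingular {0..<int p} (power_residue_rel p d)"
  unfolding nonsingular_def
proof (intro allI impI ballI)
  fix g :: "int \<Rightarrow> real" and x
  assume g: "\<forall>x\<in>{0..<int p}. (\<Sum>y\<in>power_residue_rel p d `` {x}. g y) = 0"
    and x: "x \<in> {0..<int p}"
  have p1: "p > 1" using prime_gt_1_nat[OF p] .
  have "\<not> p dvd d" using d p1 by (auto dest!: dvd_imp_le)
  then have "coprime (card (roots_of_unity p d)) p"
    using p by (simp add: card_roots_of_unity[OF p d] prime_imp_coprime coprime_commute[of d])
  moreover have "(\<Sum>s\<in>roots_of_unity p d. g ((y + s) mod int p)) = 0" for y
    using g[rule_format, of "y mod int p"] p1
    by (simp add: sum_power_residue_nbrs[OF p] mod_simps)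
  ultimately have "g (x mod int p) = 0"
    using p by (intro real_shift_sums_zero_imp_zero[of p "\<lambda>y. g (y mod int p)"]) auto
  then show "g x = 0" using x by simp
qed

lemma block_power_residue:
  assumes p: "prime p" and d: "d > 0" "even d" "d dvd p - 1"
  shows "block {0..<int p} (power_residue_rel p d) d"
proof -
  have d2: "d \<ge> 2" using d by auto
  have "sym (power_residue_rel p d)"
  proof (rule symI)
    fix x y assume "(x, y) \<in> power_residue_rel p d"
    moreover have "(x - y) ^ d = (y - x) ^ d"
      using power_minus_even[OF d(2), of "x - y"] by simp
    ultimately show "(y, x) \<in> power_residue_rel p d" by (simp add: power_residue_rel_def)
  qed
  moreover have "card (power_residue_rel p d `` {x}) = d" if "x \<in> {0..<int p}" for x
    using power_residue_nbrs[OF p that, of d] card_roots_of_unity[OF p d2 d(3)]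
    by (simp add: card_image)
  ultimately show ?thesis
    using d(1) arc_transitive_power_residue[OF p d(1)] nonsingular_power_residue[OF p d2 d(3)]
    unfolding block_def by (auto simp: power_residue_rel_def)
qed

lemma irrefl_power_residue:
  assumes p: "prime p" and d: "d > 0"
  shows "irrefl (power_residue_rel p d)"
  using d prime_gt_1_nat[OF p] by (auto simp: irrefl_def power_residue_rel_def cong_def power_0_left)

section \<open>Sizes and degrees of Kronecker products\<close>

text \<open>
  Fixing the ground type to the natural numbers allows induction over the number of Kronecker factors,
  each of which would otherwise contribute a type of its own.
\<close>

definition realizable :: "nat \<Rightarrow> nat \<Rightarrow> bool" where
  "realizable k d \<longleftrightarrow> (\<exists>(X :: nat set) R. block X R d \<and> card X = k)"

lemma realizableI:
  fixes X :: "'a::countable set"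
  assumes "block X R d"
  shows "realizable (card X) d"
proof -
  have "block (to_nat ` X) (map_prod to_nat to_nat ` R) d"
    using assms by (rule block_image[OF inj_to_nat])
  moreover have "card (to_nat ` X) = card X"
    by (rule card_image[OF inj_on_subset[OF inj_to_nat subset_UNIV]])
  ultimately show ?thesis unfolding realizable_def by blast
qed

lemma realizable_mult:
  assumes "realizable k d" "realizable k' d'"
  shows "realizable (k * k') (d * d')"
proof -
  obtain X Y :: "nat set" and R S
    where "block X R d" "card X = k" "block Y S d'" "card Y = k'"
    using assms unfolding realizable_def by blast
  then show ?thesis
    using realizableI[OF block_tensor, of X R d Y S d'] by (simp add: card_cartesian_product)
qed

lemma realizable_1: "realizable k 1"
  using realizableI[OF block_Id, of "{..<k}"] by simp

lemma realizable_complete: "k \<ge> 2 \<Longrightarrow> realizable k (k - 1)"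
  using realizableI[OF block_complete, of "{..<k}"] by simp

lemma realizable_power_residue:
  assumes "prime p" "even d" "d dvd p - 1"
  shows "realizable p d"
proof -
  have "p - 1 > 0" using prime_gt_1_nat[OF assms(1)] by simp
  then have "d > 0" using assms(3) by (auto intro: Nat.gr0I)
  then show ?thesis
    using realizableI[OF block_power_residue, of p d] assms by simp
qed

lemma realizable_prod:
  assumes "\<And>i. i \<in> I \<Longrightarrow> realizable (k i) (d i)"
  shows "realizable (\<Prod>i\<in>I. k i) (\<Prod>i\<in>I. d i)"
  using assms
proof (induction I rule: infinite_finite_induct)
  case (insert i I)
  then show ?case by (auto intro: realizable_mult)
qed (use realizable_1[of 1] in auto)

text \<open>
  By arc-transitivity, one loop forces all arcs to be loops, and then the degree is 1.
\<close>

lemma block_irrefl: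
  assumes X: "block X R d" and d: "d \<noteq> 1"
  shows "irrefl R"
proof (rule irreflI)
  fix x show "(x, x) \<notin> R"
  proof
    assume loop: "(x, x) \<in> R"
    have "y = x" if "(x, y) \<in> R" for y
      using X loop that unfolding block_def arc_transitive_def by blast
    then have "R `` {x} = {x}" using loop by auto
    moreover have "x \<in> X" using X loop by (auto simp: block_def)
    ultimately show False using X d by (auto simp: block_def)
  qed
qed

text \<open>
  A block of degree different from 1 has no loops. For degree 1, take a perfect matching: the Kronecker
  product of an identity with the complete graph on two points.
\<close>

lemma realizable_loopless:
  assumes "realizable k d" "even k"
  obtains X :: "nat set" and R where "block X R d" "card X = k" "irrefl R"
proof (cases "d = 1")
  case True
  let ?M = "tensor (Id_on {..<k div 2}) (complete_rel {..<2::nat})"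
  let ?e = "to_nat :: nat \<times> nat \<Rightarrow> nat"
  have "block ({..<k div 2} \<times> {..<2}) ?M (1 * (card {..<2::nat} - 1))"
    by (intro block_tensor block_Id block_complete) auto
  then have "block (?e ` ({..<k div 2} \<times> {..<2})) (map_prod ?e ?e ` ?M) d"
    using True by (intro block_image) auto
  moreover have "card (?e ` ({..<k div 2} \<times> {..<2})) = k"
    using assms(2) card_image[OF inj_on_subset[OF inj_to_nat subset_UNIV], of "{..<k div 2} \<times> {..<2::nat}"]
    by (simp add: card_cartesian_product)
  moreover have "irrefl (map_prod ?e ?e ` ?M)"
    by (auto simp: irrefl_def tensor_def complete_rel_def)
  ultimately show ?thesis using that by blast
next
  case False
  then show ?thesis using assms(1) that block_irrefl unfolding realizable_def by blast
qed

section \<open>Null space and orbits of a graph\<close>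

lemma pair_graphI:
  assumes "finite V" "E \<subseteq> V \<times> V" "sym E" "irrefl E"
  shows "pair_graph \<lparr>pverts = V, parcs = E\<rparr>"
proof -
  have "finite E" using assms(1,2) by (meson finite_SigmaI finite_subset)
  moreover have "symmetric (with_proj \<lparr>pverts = V, parcs = E\<rparr>)"
    using assms(3) by (simp add: symmetric_def arcs_ends_def arc_to_ends_def with_proj_def)
  ultimately show ?thesis
    using assms by unfold_locales (auto simp: irrefl_def)
qed

text \<open>
  Translates the matrix formulation into one about functions on the vertices.
\<close>

lemma nut_graphI:
  fixes G :: "'a::linorder pair_pre_digraph" and f :: "'a \<Rightarrow> real"
  assumes G: "pair_graph G" and ne: "pverts G \<noteq> {}"
    and nz: "\<And>v. v \<in> pverts G \<Longrightarrow> f v \<noteq> 0"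
    and ker: "\<And>g. (\<forall>u\<in>pverts G. (\<Sum>v\<in>parcs G `` {u}. g v) = 0) \<longleftrightarrow>
                     (\<exists>c. \<forall>v\<in>pverts G. g v = c * f v)"
  shows "nut_graph G"
proof -
  interpret pair_graph G by (rule G)
  let ?V = "pverts G"
  define vs where "vs = sorted_list_of_set ?V"
  define N where "N = card ?V"
  define A where "A = adjacency_matrix G"
  have len: "length vs = N" by (simp add: vs_def N_def)
  have bij: "bij_betw ((!) vs) {..<N} ?V"
    using pair_finite_verts len by (intro bij_betw_nth) (auto simp: vs_def)
  have A: "A \<in> carrier_mat N N"
    by (simp add: A_def adjacency_matrix_def Let_def vs_def[symmetric] len)
  define x where "x = Matrix.vec N (\<lambda>i. f (vs ! i))"
  have Ai: "(A *\<^sub>v y) $ i = (\<Sum>v\<in>parcs G `` {vs ! i}. g v)"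
    if i: "i < N" and y: "y \<in> carrier_vec N" and g: "\<And>j. j < N \<Longrightarrow> y $ j = g (vs ! j)" for i y g
  proof -
    have "(A *\<^sub>v y) $ i = (\<Sum>j<N. (if (vs ! i, vs ! j) \<in> parcs G then 1 else 0) * g (vs ! j))"
      using i y A g
      by (simp add: scalar_prod_def A_def adjacency_matrix_def Let_def vs_def[symmetric] len
          lessThan_atLeast0)
    also have "\<dots> = (\<Sum>v\<in>?V. (if (vs ! i, v) \<in> parcs G then 1 else 0) * g v)"
      using sum.reindex_bij_betw[OF bij, of "\<lambda>v. (if (vs ! i, v) \<in> parcs G then 1 else 0) * g v"]
      by simp
    also have "\<dots> = (\<Sum>v\<in>?V \<inter> {v. (vs ! i, v) \<in> parcs G}. g v)"
      unfolding sum.inter_restrict[OF pair_finite_verts] by (rule sum.cong) auto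
    also have "?V \<inter> {v. (vs ! i, v) \<in> parcs G} = parcs G `` {vs ! i}"
      using in_arcsD2 by auto
    finally show ?thesis .
  qed
  have kerA: "mat_kernel A = {c \<cdot>\<^sub>v x | c. True}"
  proof (intro equalityI subsetI)
    fix y assume "y \<in> mat_kernel A"
    then have y: "y \<in> carrier_vec N" "A *\<^sub>v y = 0\<^sub>v N" using mat_kernelD[OF A] by auto
    define g where "g = (\<lambda>v. y $ (inv_into {..<N} ((!) vs) v))"
    have g: "y $ j = g (vs ! j)" if "j < N" for j
      using that bij_betw_inv_into_left[OF bij] by (simp add: g_def)
    have "\<forall>u\<in>?V. (\<Sum>v\<in>parcs G `` {u}. g v) = 0"
    proof
      fix u assume "u \<in> ?V"
      then obtain i where "i < N" "u = vs ! i" using bij by (auto simp: bij_betw_def)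
      with Ai[of i y g] y g show "(\<Sum>v\<in>parcs G `` {u}. g v) = 0" by simp
    qed
    then obtain c where c: "\<forall>v\<in>?V. g v = c * f v" using ker by blast
    have "vs ! j \<in> ?V" if "j < N" for j using bij that by (auto simp: bij_betw_def)
    with c g y(1) have "y = c \<cdot>\<^sub>v x" by (intro eq_vecI) (auto simp: x_def)
    then show "y \<in> {c \<cdot>\<^sub>v x | c. True}" by blast
  next
    fix y assume "y \<in> {c \<cdot>\<^sub>v x | c. True}"
    then obtain c where y: "y = c \<cdot>\<^sub>v x" by blast
    have zero: "\<forall>u\<in>?V. (\<Sum>v\<in>parcs G `` {u}. c * f v) = 0"
      using ker[of "\<lambda>v. c * f v"] by blast
    have "A *\<^sub>v y = 0\<^sub>v N"
    proof (rule eq_vecI)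
      fix i assume "i < dim_vec (0\<^sub>v N :: real Matrix.vec)"
      then have i: "i < N" by simp
      then have "vs ! i \<in> ?V" using bij by (auto simp: bij_betw_def)
      with zero Ai[OF i, of y "\<lambda>v. c * f v"] i show "(A *\<^sub>v y) $ i = 0\<^sub>v N $ i"
        by (simp add: y x_def)
    qed (use A in auto)
    then show "y \<in> mat_kernel A" by (intro mat_kernelI[OF A]) (auto simp: y x_def)
  qed
  have xc: "x \<in> carrier_vec N" by (simp add: x_def)
  have xnz: "x $ i \<noteq> 0" if "i < N" for i
    using that nz bij by (auto simp: x_def bij_betw_def)
  interpret K: kernel N N A by unfold_locales (rule A)
  have "x = 1 \<cdot>\<^sub>v x" using xc by simp
  then have xk: "x \<in> mat_kernel A" unfolding kerA by blast
  have sub: "{c \<cdot>\<^sub>v x | c. True} \<subseteq> K.span {x}"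
  proof
    fix y assume "y \<in> {c \<cdot>\<^sub>v x | c. True}"
    then obtain c where "y = c \<cdot>\<^sub>v x" by blast
    then show "y \<in> K.span {x}"
      using submodule.smult_closed[OF K.Ker.span_is_submodule[of "{x}"], of c x]
        K.Ker.span_mem[of "{x}" x] xk by (simp add: class_ring_simps)
  qed
  have span: "K.span {x} = mat_kernel A"
    using sub K.Ker.span_is_subset2[of "{x}"] xk unfolding kerA by auto
  have "N > 0" using ne pair_finite_verts by (simp add: N_def card_gt_0_iff)
  then have "x \<noteq> 0\<^sub>v N" using xnz[of 0] by auto
  then have "kernel_dim A = 1"
    using K.Ker.dim1I[of x] span xk by simp
  moreover have "mat_kernel A = K.NC.span {x}"
    using K.span_same[of "{x}"] xk span by simp
  ultimately show ?thesis
    unfolding nut_graph_def A_def[symmetric] N_def[symmetric] using G xc xnz by blast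
qed

lemma orbit_aut_group:
  assumes act: "\<And>f g. (\<And>v. v \<in> V \<Longrightarrow> f v = g v) \<Longrightarrow> \<phi> f x = \<phi> g x"
  shows "orbit (aut_group \<lparr>pverts = V, parcs = E\<rparr>) \<phi> x = {\<phi> f x | f. f \<in> relation_aut V E}"
proof (intro equalityI subsetI)
  fix y assume "y \<in> orbit (aut_group \<lparr>pverts = V, parcs = E\<rparr>) \<phi> x"
  then show "y \<in> {\<phi> f x | f. f \<in> relation_aut V E}"
    by (auto simp: orbit_def aut_group_def relation_aut_def Bij_def)
next
  fix y assume "y \<in> {\<phi> f x | f. f \<in> relation_aut V E}"
  then obtain f where f: "f \<in> relation_aut V E" "y = \<phi> f x" by blast
  have "bij_betw (restrict f V) V V"
    using relation_aut_bij[OF f(1)] by (rule bij_betw_cong[THEN iffD1, rotated]) simp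
  then have "restrict f V \<in> carrier (aut_group \<lparr>pverts = V, parcs = E\<rparr>)"
    using relation_aut_iff[OF f(1)] by (simp add: aut_group_def Bij_def)
  moreover have "y = \<phi> (restrict f V) x"
    unfolding f(2) by (rule act) simp
  ultimately show "y \<in> orbit (aut_group \<lparr>pverts = V, parcs = E\<rparr>) \<phi> x"
    unfolding orbit_def by blast
qed

lemma orbits_eq_partition:
  assumes "\<Union>P = S" "{} \<notin> P" "\<And>A x. A \<in> P \<Longrightarrow> x \<in> A \<Longrightarrow> orbit G \<phi> x = A"
  shows "orbits G S \<phi> = P"
proof (intro equalityI subsetI)
  fix A assume "A \<in> P"
  then obtain x where "x \<in> A" using assms(2) by (metis ex_in_conv)
  then show "A \<in> orbits G S \<phi>" using assms \<open>A \<in> P\<close> unfolding orbits_def by blast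
qed (use assms in \<open>auto simp: orbits_def\<close>)

text \<open>
  An arc-transitive, automorphism-invariant set of arcs underlies a single edge orbit.
\<close>

lemma edge_orbit_of_arc_transitive:
  assumes tr: "arc_transitive V E S" and SV: "S \<subseteq> V \<times> V"
    and pres: "\<And>f u v. f \<in> relation_aut V E \<Longrightarrow> (u, v) \<in> S \<Longrightarrow> (f u, f v) \<in> S"
    and e: "e \<in> {{u, v} | u v. (u, v) \<in> S}"
  shows "orbit (aut_group \<lparr>pverts = V, parcs = E\<rparr>) (\<lambda>f e. f ` e) e = {{u, v} | u v. (u, v) \<in> S}"
proof -
  obtain u v where uv: "(u, v) \<in> S" "e = {u, v}" using e by blast
  have "orbit (aut_group \<lparr>pverts = V, parcs = E\<rparr>) (\<lambda>f e. f ` e) e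
      = {f ` e | f. f \<in> relation_aut V E}"
    using uv SV by (intro orbit_aut_group image_cong) auto
  also have "\<dots> = {{u, v} | u v. (u, v) \<in> S}"
  proof (intro equalityI subsetI)
    fix y assume "y \<in> {f ` e | f. f \<in> relation_aut V E}"
    then show "y \<in> {{u, v} | u v. (u, v) \<in> S}" using pres uv by fastforce
  next
    fix y assume "y \<in> {{u, v} | u v. (u, v) \<in> S}"
    then obtain u' v' where "(u', v') \<in> S" "y = {u', v'}" by blast
    moreover from this obtain f where "f \<in> relation_aut V E" "f u = u'" "f v = v'"
      using tr uv unfolding arc_transitive_def by blast
    ultimately show "y \<in> {f ` e | f. f \<in> relation_aut V E}" using uv by force
  qed
  finally show ?thesis .
qed

text \<open>
  The degrees keep the two parts apart, so each of the arc sets \<open>S1\<close>, \<open>S2\<close>, \<open>J\<close> is invariant under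
  automorphisms and yields one edge orbit. Each vertex lies on an arc of \<open>J\<close>, so transitivity on \<open>J\<close>
  also gives transitivity on the vertices of each part.
\<close>

lemma orbit_counts_2_3:
  assumes V: "V = V1 \<union> V2" and E: "E = S1 \<union> S2 \<union> J \<union> J\<inverse>"
    and S1: "S1 \<subseteq> V1 \<times> V1" "S1 \<noteq> {}" "sym S1" and S2: "S2 \<subseteq> V2 \<times> V2" "S2 \<noteq> {}" "sym S2"
    and J: "Domain J = V1" "Range J = V2"
    and tr: "arc_transitive V E S1" "arc_transitive V E S2" "arc_transitive V E J"
    and deg: "\<And>v. v \<in> V1 \<Longrightarrow> card (E `` {v}) = k1" "\<And>v. v \<in> V2 \<Longrightarrow> card (E `` {v}) = k2"
      "k1 \<noteq> k2"
  shows "num_vertex_orbits \<lparr>pverts = V, parcs = E\<rparr> = 2"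
    and "num_edge_orbits \<lparr>pverts = V, parcs = E\<rparr> = 3"
proof -
  let ?G = "\<lparr>pverts = V, parcs = E\<rparr>"
  have EV: "E \<subseteq> V \<times> V" using S1 S2 J by (auto simp: V E)
  have disj: "V1 \<inter> V2 = {}" using deg by force
  obtain u0 v0 where "(u0, v0) \<in> S1" using S1 by auto
  then have ne1: "V1 \<noteq> {}" using S1 by auto
  then have ne2: "V2 \<noteq> {}" using J by auto
  have f1: "f v \<in> V1" if "f \<in> relation_aut V E" "v \<in> V1" for f v
    using relation_aut_card_nbrs[OF that(1) EV, of v] relation_aut_closed[OF that(1), of v]
      deg that(2) by (auto simp: V)
  have f2: "f v \<in> V2" if "f \<in> relation_aut V E" "v \<in> V2" for f v
    using relation_aut_card_nbrs[OF that(1) EV, of v] relation_aut_closed[OF that(1), of v]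
      deg that(2) by (auto simp: V)
  have orb: "orbit (aut_group ?G) (\<lambda>f v. f v) x = {f x | f. f \<in> relation_aut V E}"
    if "x \<in> V" for x
    using that orbit_aut_group[where V = V and E = E and x = x and \<phi> = "\<lambda>f v. f v"] by blast
  have "orbit (aut_group ?G) (\<lambda>f v. f v) x = V1" if x: "x \<in> V1" for x
  proof -
    have "y \<in> {f x | f. f \<in> relation_aut V E}" if y: "y \<in> V1" for y
    proof -
      obtain x' y' where "(x, x') \<in> J" "(y, y') \<in> J" using x y J by blast
      then show ?thesis using tr(3) unfolding arc_transitive_def by blast
    qed
    then show ?thesis using orb[of x] x f1 by (auto simp: V)
  qed
  moreover have "orbit (aut_group ?G) (\<lambda>f v. f v) x = V2" if x: "x \<in> V2" for x
  proof -
    have "y \<in> {f x | f. f \<in> relation_aut V E}" if y: "y \<in> V2" for y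
    proof -
      obtain x' y' where "(x', x) \<in> J" "(y', y) \<in> J" using x y J by blast
      then show ?thesis using tr(3) unfolding arc_transitive_def by blast
    qed
    then show ?thesis using orb[of x] x f2 by (auto simp: V)
  qed
  ultimately have "orbits (aut_group ?G) V (\<lambda>f v. f v) = {V1, V2}"
    using ne1 ne2 by (intro orbits_eq_partition) (auto simp: V)
  moreover have "V1 \<noteq> V2" using disj ne1 by auto
  ultimately show "num_vertex_orbits ?G = 2" by (simp add: num_vertex_orbits_def)
  have EV1: "(u, v) \<in> S1 \<longleftrightarrow> (u, v) \<in> E \<and> u \<in> V1 \<and> v \<in> V1" for u v
    using S1 S2 J disj by (auto simp: E)
  have EV2: "(u, v) \<in> S2 \<longleftrightarrow> (u, v) \<in> E \<and> u \<in> V2 \<and> v \<in> V2" for u v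
    using S1 S2 J disj by (auto simp: E)
  have EVJ: "(u, v) \<in> J \<longleftrightarrow> (u, v) \<in> E \<and> u \<in> V1 \<and> v \<in> V2" for u v
    using S1 S2 J disj by (auto simp: E)
  define F where "F = (\<lambda>S :: ('a \<times> 'a) set. {{u, v} | u v. (u, v) \<in> S})"
  have F_iff: "{u, v} \<in> F S \<longleftrightarrow> (u, v) \<in> S \<or> (v, u) \<in> S" for u v S
    unfolding F_def by (auto simp: doubleton_eq_iff)
  have inE: "(f u, f v) \<in> E" if "f \<in> relation_aut V E" "(u, v) \<in> E" for f u v
    using relation_aut_iff[OF that(1), of u v] that EV by auto
  have "orbit (aut_group ?G) (\<lambda>f e. f ` e) e = F S1" if "e \<in> F S1" for e
    unfolding F_def
    by (rule edge_orbit_of_arc_transitive[OF tr(1) _ _ that[unfolded F_def]])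
      (use f1 inE in \<open>auto simp: EV1 V\<close>)
  moreover have "orbit (aut_group ?G) (\<lambda>f e. f ` e) e = F S2" if "e \<in> F S2" for e
    unfolding F_def
    by (rule edge_orbit_of_arc_transitive[OF tr(2) _ _ that[unfolded F_def]])
      (use f2 inE in \<open>auto simp: EV2 V\<close>)
  moreover have "orbit (aut_group ?G) (\<lambda>f e. f ` e) e = F J" if "e \<in> F J" for e
    unfolding F_def
    by (rule edge_orbit_of_arc_transitive[OF tr(3) _ _ that[unfolded F_def]])
      (use f1 f2 inE in \<open>auto simp: EVJ V\<close>)
  moreover have "F S1 \<union> F S2 \<union> F J = edges ?G"
    by (auto simp: edges_def E F_def)
  moreover have "{u, v} \<in> F S \<Longrightarrow> {} \<noteq> F S" for u v S by blast
  then have "{} \<notin> {F S1, F S2, F J}"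
    using S1(2) S2(2) J ne1 F_iff by (metis Domain_empty all_not_in_conv insertE old.prod.exhaust singletonD)
  ultimately have orbs: "orbits (aut_group ?G) (edges ?G) (\<lambda>f e. f ` e) = {F S1, F S2, F J}"
    by (intro orbits_eq_partition) auto
  obtain u1 v1 where uv: "(u1, v1) \<in> J" using J ne1 by auto
  have "{u0, v0} \<in> F S1" "{u0, v0} \<notin> F S2" "{u1, v1} \<in> F J" "{u1, v1} \<notin> F S1" "{u1, v1} \<notin> F S2"
    using \<open>(u0, v0) \<in> S1\<close> uv disj unfolding F_iff EV1 EV2 EVJ by auto
  then have "F S1 \<noteq> F S2" "F S1 \<noteq> F J" "F S2 \<noteq> F J" by auto
  then show "num_edge_orbits ?G = 3" by (simp add: num_edge_orbits_def orbs)
qed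

text \<open>
  A countable vertex type is encoded in the natural numbers, where the graph has to live.
\<close>

lemma nut_graph_of_relation:
  fixes V1 V2 :: "'v::countable set" and w :: "'v \<Rightarrow> real"
  assumes V: "V = V1 \<union> V2" and E: "E = S1 \<union> S2 \<union> J \<union> J\<inverse>" and fin: "finite V"
    and S1: "S1 \<subseteq> V1 \<times> V1" "S1 \<noteq> {}" "sym S1" "irrefl S1"
    and S2: "S2 \<subseteq> V2 \<times> V2" "S2 \<noteq> {}" "sym S2" "irrefl S2"
    and J: "Domain J = V1" "Range J = V2"
    and tr: "arc_transitive V E S1" "arc_transitive V E S2" "arc_transitive V E J"
    and deg: "\<And>v. v \<in> V1 \<Longrightarrow> card (E `` {v}) = k1" "\<And>v. v \<in> V2 \<Longrightarrow> card (E `` {v}) = k2"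
      "k1 \<noteq> k2"
    and nz: "\<And>v. v \<in> V \<Longrightarrow> w v \<noteq> 0"
    and ker: "\<And>g. (\<forall>u\<in>V. (\<Sum>v\<in>E `` {u}. g v) = 0) \<longleftrightarrow> (\<exists>c. \<forall>v\<in>V. g v = c * w v)"
  shows "\<exists>G :: nat pair_pre_digraph. nut_graph G \<and> num_vertex_orbits G = 2 \<and>
           num_edge_orbits G = 3 \<and> card (pverts G) = card V"
proof -
  let ?e = "to_nat :: 'v \<Rightarrow> nat"
  let ?r = "\<lambda>R. map_prod ?e ?e ` R"
  let ?G = "\<lparr>pverts = ?e ` V, parcs = ?r E\<rparr>"
  have e: "inj ?e" by simp
  have inj: "inj_on ?e A" for A by (rule inj_on_subset[OF e subset_UNIV])
  have EV: "E \<subseteq> V \<times> V" using S1 S2 J by (auto simp: V E)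
  have disj: "V1 \<inter> V2 = {}" using deg by force
  have symr: "sym (?r R)" if "sym R" for R
    using that by (auto simp: sym_def)
  have eV: "?e ` V = ?e ` V1 \<union> ?e ` V2" by (simp add: V image_Un)
  have eE: "?r E = ?r S1 \<union> ?r S2 \<union> ?r J \<union> (?r J)\<inverse>" by (auto simp: E image_Un)
  have tr': "arc_transitive (?e ` V) (?r E) (?r S)" if "arc_transitive V E S" for S
    by (rule arc_transitive_image[OF e EV that])
  have deg': "card (?r E `` {v}) = k1" if "v \<in> ?e ` V1" for v
    using that deg(1) by (auto simp: image_nbrs[OF e] card_image[OF inj])
  have deg'': "card (?r E `` {v}) = k2" if "v \<in> ?e ` V2" for v
    using that deg(2) by (auto simp: image_nbrs[OF e] card_image[OF inj])
  have "sym E" using S1 S2 by (auto simp: E sym_def)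
  moreover have "irrefl E" using S1 S2 J disj by (auto simp: E irrefl_def)
  ultimately have G: "pair_graph ?G"
    using fin EV by (intro pair_graphI symr) (auto simp: irrefl_def)
  have "nut_graph ?G"
  proof (rule nut_graphI[where f = "w \<circ> inv_into UNIV ?e"])
    show "pair_graph ?G" by (rule G)
    show "pverts ?G \<noteq> {}" using S1 by (auto simp: V)
    show "(w \<circ> inv_into UNIV ?e) v \<noteq> 0" if "v \<in> pverts ?G" for v
      using that nz by auto
    fix g :: "nat \<Rightarrow> real"
    have "(\<forall>u\<in>pverts ?G. (\<Sum>v\<in>parcs ?G `` {u}. g v) = 0)
        \<longleftrightarrow> (\<forall>u\<in>V. (\<Sum>v\<in>E `` {u}. (g \<circ> ?e) v) = 0)"
      by (simp add: image_nbrs[OF e] sum.reindex[OF inj])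
    also have "\<dots> \<longleftrightarrow> (\<exists>c. \<forall>v\<in>V. (g \<circ> ?e) v = c * w v)" by (rule ker)
    finally show "(\<forall>u\<in>pverts ?G. (\<Sum>v\<in>parcs ?G `` {u}. g v) = 0)
        \<longleftrightarrow> (\<exists>c. \<forall>v\<in>pverts ?G. g v = c * (w \<circ> inv_into UNIV ?e) v)" by simp
  qed
  moreover have "num_vertex_orbits ?G = 2" "num_edge_orbits ?G = 3"
    by (rule orbit_counts_2_3[OF eV eE _ _ _ _ _ _ _ _ tr'[OF tr(1)] tr'[OF tr(2)] tr'[OF tr(3)]
          deg' deg'' deg(3)];
        use S1 S2 J in \<open>auto intro!: symr\<close>; force)+
  moreover have "card (pverts ?G) = card V" by (simp add: card_image[OF inj])
  ultimately show ?thesis by blast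
qed

section \<open>The two-part graph over a base\<close>

lemma block_finite: "block X R d \<Longrightarrow> finite X"
  and block_subset: "block X R d \<Longrightarrow> R \<subseteq> X \<times> X"
  and block_sym: "block X R d \<Longrightarrow> sym R"
  and block_degree_pos: "block X R d \<Longrightarrow> d > 0"
  and block_degree: "block X R d \<Longrightarrow> x \<in> X \<Longrightarrow> card (R `` {x}) = d"
  and block_arc_transitive: "block X R d \<Longrightarrow> arc_transitive X R R"
  and block_nonsingular: "block X R d \<Longrightarrow> nonsingular X R"
  by (auto simp: block_def)

lemma block_nbrs_subset: "block X R d \<Longrightarrow> R `` {x} \<subseteq> X"
  using block_subset by fastforce

lemma block_nbrs_finite: "block X R d \<Longrightarrow> finite (R `` {x})"
  using block_nbrs_subset block_finite by (meson finite_subset)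

lemma block_nbr_exists:
  assumes "block X R d" "x \<in> X"
  obtains y where "(x, y) \<in> R" "y \<in> X"
proof -
  have "R `` {x} \<noteq> {}"
    using block_degree[OF assms] block_degree_pos[OF assms(1)] by auto
  then show ?thesis using that block_nbrs_subset[OF assms(1), of x] by blast
qed

lemma block_vertex_transitive:
  assumes X: "block X R d" and "x \<in> X" "y \<in> X"
  obtains f where "f \<in> relation_aut X R" "f x = y"
  using block_nbr_exists[OF X assms(2)] block_nbr_exists[OF X assms(3)] block_arc_transitive[OF X]
  unfolding arc_transitive_def by metis

text \<open>
  A regular relation maps the constant \<open>c / d\<close> to \<open>c\<close>; by nonsingularity it is the only preimage.
\<close>

lemma block_sum_eq_const:
  fixes h :: "'a \<Rightarrow> real"
  assumes X: "block X R d" and h: "\<And>x. x \<in> X \<Longrightarrow> (\<Sum>y\<in>R `` {x}. h y) = c" and x: "x \<in> X"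
  shows "h x = c / real d"
proof -
  have "(\<Sum>y\<in>R `` {x}. h y - c / real d) = 0" if "x \<in> X" for x
    using h[OF that] block_degree[OF X that] block_degree_pos[OF X] by (simp add: sum_subtractf)
  then have "h x - c / real d = 0"
    using block_nonsingular[OF X] x unfolding nonsingular_def by blast
  then show ?thesis by simp
qed

lemma block_sum_inj:
  fixes h h' :: "'a \<Rightarrow> real"
  assumes X: "block X R d" and h: "\<And>x. x \<in> X \<Longrightarrow> (\<Sum>y\<in>R `` {x}. h y) = (\<Sum>y\<in>R `` {x}. h' y)"
    and x: "x \<in> X"
  shows "h x = h' x"
  using block_sum_eq_const[OF X, of "\<lambda>x. h x - h' x" 0 x] h x by (simp add: sum_subtractf)

text \<open>
  If the Kronecker product of \<open>A\<close> and \<open>M\<close> maps \<open>g\<close> to a function of the first coordinate only, then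
  \<open>g\<close> depends on the first coordinate only: inverting \<open>M\<close> divides \<open>s\<close> by the degree of \<open>M\<close>, and \<open>A\<close> is
  injective.
\<close>

lemma tensor_block_solution:
  fixes g :: "'a \<times> 'b \<Rightarrow> real"
  assumes N: "block N A a" and X: "block X M d"
    and eq: "\<And>x u. x \<in> N \<Longrightarrow> u \<in> X \<Longrightarrow> (\<Sum>q\<in>tensor A M `` {(x, u)}. g q) = s x"
    and u: "u \<in> X"
  shows "x \<in> N \<Longrightarrow> (\<Sum>y\<in>A `` {x}. g (y, u)) = s x / real d"
    and "x \<in> N \<Longrightarrow> u' \<in> X \<Longrightarrow> g (x, u) = g (x, u')"
proof -
  have *: "(\<Sum>y\<in>A `` {x}. g (y, u)) = s x / real d" if x: "x \<in> N" and u: "u \<in> X" for x u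
  proof (rule block_sum_eq_const[OF X _ u])
    fix v assume "v \<in> X"
    have "(\<Sum>u'\<in>M `` {v}. \<Sum>y\<in>A `` {x}. g (y, u')) = (\<Sum>y\<in>A `` {x}. \<Sum>u'\<in>M `` {v}. g (y, u'))"
      by (rule sum.swap)
    also have "\<dots> = (\<Sum>q\<in>tensor A M `` {(x, v)}. g q)"
      by (simp add: tensor_nbrs sum.cartesian_product)
    also have "\<dots> = s x" by (rule eq[OF x \<open>v \<in> X\<close>])
    finally show "(\<Sum>u'\<in>M `` {v}. \<Sum>y\<in>A `` {x}. g (y, u')) = s x" .
  qed
  show "x \<in> N \<Longrightarrow> (\<Sum>y\<in>A `` {x}. g (y, u)) = s x / real d" using * u by blast
  show "x \<in> N \<Longrightarrow> u' \<in> X \<Longrightarrow> g (x, u) = g (x, u')"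
    by (rule block_sum_inj[OF N, of "\<lambda>x. g (x, u)" "\<lambda>x. g (x, u')"]) (simp_all add: * u)
qed

text \<open>
  Equality in an average of values bounded by \<open>m\<close>.
\<close>

lemma sum_block_maximum:
  fixes p :: "'a \<Rightarrow> real"
  assumes X: "block X R d" and le: "\<And>y. y \<in> X \<Longrightarrow> p y \<le> m"
    and sum: "(\<Sum>y\<in>R `` {x}. p y) = real d * m" and x: "x \<in> X" and y: "(x, y) \<in> R"
  shows "p y = m"
proof -
  have "(\<Sum>y\<in>R `` {x}. m - p y) = 0"
    using sum block_degree[OF X x] by (simp add: sum_subtractf)
  then have "\<forall>y\<in>R `` {x}. m - p y = 0"
    using le block_nbrs_subset[OF X, of x] block_nbrs_finite[OF X, of x]
    by (subst (asm) sum_nonneg_eq_0_iff) auto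
  then show ?thesis using y by auto
qed

text \<open>
  The two-part construction over a base \<open>N\<close> that carries the relations \<open>A\<close> and \<open>B\<close>. Every automorphism
  of \<open>A\<close> must also preserve \<open>B\<close>, as it acts on both parts at once to keep the edges between them;
  the automorphisms of \<open>A\<close> must be transitive on the arcs of \<open>B\<close>. By \<open>harm\<close>, the eigenvectors of
  \<open>B A\<close> with eigenvalue \<open>a b\<close> are constant. The null vector \<open>w\<close> comes from the \<open>2 \<times> 2\<close> quotient
  matrix of the partition into the two parts, whose determinant vanishes by \<open>bal\<close>.
\<close>

lemma nut_graph_of_blocks:
  fixes N :: "'n::countable set" and X :: "'x::countable set" and Y :: "'y::countable set"
  assumes N: "block N A a" "block N B b" and ne: "N \<noteq> {}" "X \<noteq> {}" "Y \<noteq> {}"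
    and irr: "irrefl A" "irrefl T"
    and AB: "relation_aut N A \<subseteq> relation_aut N B" "arc_transitive N A B"
    and harm: "\<And>(p :: 'n \<Rightarrow> real) x y.
          (\<And>x. x \<in> N \<Longrightarrow> (\<Sum>y\<in>B `` {x}. \<Sum>z\<in>A `` {y}. p z) = real (a * b) * p x) \<Longrightarrow>
          x \<in> N \<Longrightarrow> y \<in> N \<Longrightarrow> p x = p y"
    and X: "block X M \<mu>" and Y: "block Y T \<tau>"
    and bal: "a * b * \<mu> * \<tau> = card X * card Y"
    and deg: "card Y + a * \<mu> \<noteq> card X + b * \<tau>"
  shows "\<exists>G :: nat pair_pre_digraph. nut_graph G \<and> num_vertex_orbits G = 2 \<and>
           num_edge_orbits G = 3 \<and> card (pverts G) = card N * (card X + card Y)"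
proof -
  define V1 :: "(('n \<times> 'x) + ('n \<times> 'y)) set" where "V1 = Inl ` (N \<times> X)"
  define V2 :: "(('n \<times> 'x) + ('n \<times> 'y)) set" where "V2 = Inr ` (N \<times> Y)"
  define V where "V = V1 \<union> V2"
  define S1 :: "(('n \<times> 'x) + ('n \<times> 'y)) rel" where "S1 = map_prod Inl Inl ` tensor A M"
  define S2 :: "(('n \<times> 'x) + ('n \<times> 'y)) rel" where "S2 = map_prod Inr Inr ` tensor B T"
  define J :: "(('n \<times> 'x) + ('n \<times> 'y)) rel"
    where "J = {(Inl (x, u), Inr (x, w)) | x u w. x \<in> N \<and> u \<in> X \<and> w \<in> Y}"
  define E where "E = S1 \<union> S2 \<union> J \<union> J\<inverse>"
  define w :: "('n \<times> 'x) + ('n \<times> 'y) \<Rightarrow> real"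
    where "w = case_sum (\<lambda>_. real (card Y)) (\<lambda>_. - real (a * \<mu>))"
  have AM: "block (N \<times> X) (tensor A M) (a * \<mu>)" by (rule block_tensor[OF N(1) X])
  have BT: "block (N \<times> Y) (tensor B T) (b * \<tau>)" by (rule block_tensor[OF N(2) Y])
  note finite = block_finite[OF N(1)] block_finite[OF X] block_finite[OF Y]
  have pos: "card X > 0" "card Y > 0" "a > 0" "b > 0" "\<mu> > 0" "\<tau> > 0"
    using ne finite block_degree_pos N X Y by (auto simp: card_gt_0_iff)
  have S1V: "S1 \<subseteq> V1 \<times> V1" using block_subset[OF AM] by (auto simp: S1_def V1_def)
  have S2V: "S2 \<subseteq> V2 \<times> V2" using block_subset[OF BT] by (auto simp: S2_def V2_def)
  have nbrs1: "E `` {Inl (x, u)} = Inl ` (tensor A M `` {(x, u)}) \<union> Inr ` ({x} \<times> Y)"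
    if "x \<in> N" "u \<in> X" for x u
    using that by (auto simp: E_def S1_def S2_def J_def)
  have nbrs2: "E `` {Inr (x, v)} = Inr ` (tensor B T `` {(x, v)}) \<union> Inl ` ({x} \<times> X)"
    if "x \<in> N" "v \<in> Y" for x v
    using that by (auto simp: E_def S1_def S2_def J_def)
  have pairs: "c ` ({x} \<times> Z) = (\<lambda>z. c (x, z)) ` Z" for c :: "'n \<times> 'z \<Rightarrow> 'c" and x Z by auto
  have sum1: "(\<Sum>v\<in>E `` {Inl (x, u)}. g v)
      = (\<Sum>q\<in>tensor A M `` {(x, u)}. g (Inl q)) + (\<Sum>v\<in>Y. g (Inr (x, v)))"
    if "x \<in> N" "u \<in> X" for x u and g :: "_ \<Rightarrow> real"
  proof -
    have "(\<Sum>v\<in>Inr ` ({x} \<times> Y). g v) = (\<Sum>v\<in>Y. g (Inr (x, v)))"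
      unfolding pairs[of Inr x Y] by (simp add: sum.reindex inj_on_def)
    then show ?thesis
      unfolding nbrs1[OF that] using block_nbrs_finite[OF AM] finite
      by (subst sum.union_disjoint) (auto simp: sum.reindex)
  qed
  have sum2: "(\<Sum>v\<in>E `` {Inr (x, v)}. g v)
      = (\<Sum>q\<in>tensor B T `` {(x, v)}. g (Inr q)) + (\<Sum>u\<in>X. g (Inl (x, u)))"
    if "x \<in> N" "v \<in> Y" for x v and g :: "_ \<Rightarrow> real"
  proof -
    have "(\<Sum>v\<in>Inl ` ({x} \<times> X). g v) = (\<Sum>u\<in>X. g (Inl (x, u)))"
      unfolding pairs[of Inl x X] by (simp add: sum.reindex inj_on_def)
    then show ?thesis
      unfolding nbrs2[OF that] using block_nbrs_finite[OF BT] finite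
      by (subst sum.union_disjoint) (auto simp: sum.reindex)
  qed
  have E_iff:
    "(Inl (x, u), Inl (y, u')) \<in> E \<longleftrightarrow> (x, y) \<in> A \<and> (u, u') \<in> M"
    "(Inr (x, v), Inr (y, v')) \<in> E \<longleftrightarrow> (x, y) \<in> B \<and> (v, v') \<in> T"
    "(Inl (x, u), Inr (y, v)) \<in> E \<longleftrightarrow> x = y \<and> x \<in> N \<and> u \<in> X \<and> v \<in> Y"
    "(Inr (x, v), Inl (y, u)) \<in> E \<longleftrightarrow> x = y \<and> x \<in> N \<and> u \<in> X \<and> v \<in> Y"
    for x y u u' v v'
    by (auto simp: E_def S1_def S2_def J_def tensor_def image_iff)
  have aut: "map_sum (map_prod \<phi> f) (map_prod \<phi> h) \<in> relation_aut V E"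
    if \<phi>: "\<phi> \<in> relation_aut N A" and f: "f \<in> relation_aut X M" and h: "h \<in> relation_aut Y T"
    for \<phi> f h
  proof (rule relation_autI)
    let ?F = "map_sum (map_prod \<phi> f) (map_prod \<phi> h)"
    have "inj_on \<phi> N" "\<phi> ` N = N" "f ` X = X" "h ` Y = Y"
      using \<phi>[THEN relation_aut_bij] f[THEN relation_aut_bij] h[THEN relation_aut_bij]
      by (simp_all add: bij_betw_def)
    moreover have "?F ` V = Inl ` (map_prod \<phi> f ` (N \<times> X)) \<union> Inr ` (map_prod \<phi> h ` (N \<times> Y))"
      by (simp add: V_def V1_def V2_def image_Un image_image)
    ultimately have "?F ` V = V"
      by (simp add: V_def V1_def V2_def map_prod_surj_on)
    moreover have "finite V" using finite by (simp add: V_def V1_def V2_def)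
    ultimately show "bij_betw ?F V V"
      by (simp add: bij_betw_def finite_surj_inj)
    note \<phi>A = relation_aut_iff[OF \<phi>] and \<phi>B = relation_aut_iff[OF subsetD[OF AB(1) \<phi>]]
    note closed = relation_aut_closed[OF \<phi>] relation_aut_closed[OF f] relation_aut_closed[OF h]
    note \<phi>_eq = inj_on_eq_iff[OF \<open>inj_on \<phi> N\<close>]
    fix p q assume "p \<in> V" "q \<in> V"
    then consider
        x u y u' where "p = Inl (x, u)" "q = Inl (y, u')" "x \<in> N" "y \<in> N" "u \<in> X" "u' \<in> X"
      | x v y v' where "p = Inr (x, v)" "q = Inr (y, v')" "x \<in> N" "y \<in> N" "v \<in> Y" "v' \<in> Y"
      | x u y v where "p = Inl (x, u)" "q = Inr (y, v)" "x \<in> N" "y \<in> N" "u \<in> X" "v \<in> Y"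
      | x v y u where "p = Inr (x, v)" "q = Inl (y, u)" "x \<in> N" "y \<in> N" "u \<in> X" "v \<in> Y"
      unfolding V_def V1_def V2_def by blast
    then show "(?F p, ?F q) \<in> E \<longleftrightarrow> (p, q) \<in> E"
    proof cases
      case 1
      then show ?thesis by (simp add: E_iff \<phi>A relation_aut_iff[OF f])
    next
      case 2
      then show ?thesis by (simp add: E_iff \<phi>B relation_aut_iff[OF h])
    next
      case 3
      then show ?thesis by (simp add: E_iff \<phi>_eq closed)
    next
      case 4
      then show ?thesis by (simp add: E_iff \<phi>_eq closed)
    qed
  qed
  have id: "id \<in> relation_aut Z R" for Z :: "'z set" and R by (simp add: relation_aut_def)
  have tr1: "arc_transitive V E S1"
    unfolding arc_transitive_def
  proof (intro allI impI)
    fix p q p' q' assume "(p, q) \<in> S1" "(p', q') \<in> S1"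
    then obtain x u y v x' u' y' v' where
      *: "(x, y) \<in> A" "(u, v) \<in> M" "(x', y') \<in> A" "(u', v') \<in> M"
      "p = Inl (x, u)" "q = Inl (y, v)" "p' = Inl (x', u')" "q' = Inl (y', v')"
      by (auto simp: S1_def tensor_def)
    then obtain \<phi> f where "\<phi> \<in> relation_aut N A" "\<phi> x = x'" "\<phi> y = y'"
      "f \<in> relation_aut X M" "f u = u'" "f v = v'"
      using block_arc_transitive[OF N(1)] block_arc_transitive[OF X]
      unfolding arc_transitive_def by metis
    with * aut[OF _ _ id] show "\<exists>F\<in>relation_aut V E. F p = p' \<and> F q = q'"
      by (intro bexI[of _ "map_sum (map_prod \<phi> f) (map_prod \<phi> id)"]) auto
  qed
  have tr2: "arc_transitive V E S2"
    unfolding arc_transitive_def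
  proof (intro allI impI)
    fix p q p' q' assume "(p, q) \<in> S2" "(p', q') \<in> S2"
    then obtain x u y v x' u' y' v' where
      *: "(x, y) \<in> B" "(u, v) \<in> T" "(x', y') \<in> B" "(u', v') \<in> T"
      "p = Inr (x, u)" "q = Inr (y, v)" "p' = Inr (x', u')" "q' = Inr (y', v')"
      by (auto simp: S2_def tensor_def)
    then obtain \<phi> h where "\<phi> \<in> relation_aut N A" "\<phi> x = x'" "\<phi> y = y'"
      "h \<in> relation_aut Y T" "h u = u'" "h v = v'"
      using AB(2) block_arc_transitive[OF Y] unfolding arc_transitive_def by metis
    with * aut[OF _ id] show "\<exists>F\<in>relation_aut V E. F p = p' \<and> F q = q'"
      by (intro bexI[of _ "map_sum (map_prod \<phi> id) (map_prod \<phi> h)"]) auto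
  qed
  have trJ: "arc_transitive V E J"
    unfolding arc_transitive_def
  proof (intro allI impI)
    fix p q p' q' assume "(p, q) \<in> J" "(p', q') \<in> J"
    then obtain x u v x' u' v' where
      *: "x \<in> N" "u \<in> X" "v \<in> Y" "x' \<in> N" "u' \<in> X" "v' \<in> Y"
      "p = Inl (x, u)" "q = Inr (x, v)" "p' = Inl (x', u')" "q' = Inr (x', v')"
      by (auto simp: J_def)
    obtain \<phi> f h where "\<phi> \<in> relation_aut N A" "\<phi> x = x'"
      "f \<in> relation_aut X M" "f u = u'" "h \<in> relation_aut Y T" "h v = v'"
      using block_vertex_transitive[OF N(1) *(1,4)] block_vertex_transitive[OF X *(2,5)]
        block_vertex_transitive[OF Y *(3,6)] by metis
    with * aut show "\<exists>F\<in>relation_aut V E. F p = p' \<and> F q = q'"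
      by (intro bexI[of _ "map_sum (map_prod \<phi> f) (map_prod \<phi> h)"]) auto
  qed
  have deg1: "card (E `` {p}) = card Y + a * \<mu>" if "p \<in> V1" for p
  proof -
    obtain x u where p: "p = Inl (x, u)" "x \<in> N" "u \<in> X" using \<open>p \<in> V1\<close> by (auto simp: V1_def)
    \<comment> \<open>The degree is the neighbourhood sum of the constant function \<open>1\<close>.\<close>
    have "real (card (E `` {p})) = real (card Y + a * \<mu>)"
      using sum1[OF p(2,3), of "\<lambda>_. 1"] block_degree[OF AM, of "(x, u)"] p by simp
    then show ?thesis by (simp only: of_nat_eq_iff)
  qed
  have deg2: "card (E `` {p}) = card X + b * \<tau>" if "p \<in> V2" for p
  proof -
    obtain x v where p: "p = Inr (x, v)" "x \<in> N" "v \<in> Y" using \<open>p \<in> V2\<close> by (auto simp: V2_def)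
    have "real (card (E `` {p})) = real (card X + b * \<tau>)"
      using sum2[OF p(2,3), of "\<lambda>_. 1"] block_degree[OF BT, of "(x, v)"] p by simp
    then show ?thesis by (simp only: of_nat_eq_iff)
  qed
  have bal': "real a * real b * real \<mu> * real \<tau> = real (card X) * real (card Y)"
    using arg_cong[OF bal, of real] by simp
  have ker: "(\<forall>u\<in>V. (\<Sum>v\<in>E `` {u}. g v) = 0) \<longleftrightarrow> (\<exists>c. \<forall>v\<in>V. g v = c * w v)"
    for g :: "_ \<Rightarrow> real"
  proof
    assume g: "\<forall>u\<in>V. (\<Sum>v\<in>E `` {u}. g v) = 0"
    obtain u0 v0 where u0: "u0 \<in> X" and v0: "v0 \<in> Y" using ne by blast
    define p where "p = (\<lambda>x. g (Inl (x, u0)))"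
    define q where "q = (\<lambda>x. g (Inr (x, v0)))"
    have eq1: "(\<Sum>r\<in>tensor A M `` {(x, u)}. g (Inl r)) = - (\<Sum>v\<in>Y. g (Inr (x, v)))"
      if "x \<in> N" "u \<in> X" for x u
      using sum1[OF that, of g] g that by (simp add: V_def V1_def eq_neg_iff_add_eq_0)
    have eq2: "(\<Sum>r\<in>tensor B T `` {(x, v)}. g (Inr r)) = - (\<Sum>u\<in>X. g (Inl (x, u)))"
      if "x \<in> N" "v \<in> Y" for x v
      using sum2[OF that, of g] g that by (simp add: V_def V2_def eq_neg_iff_add_eq_0)
    \<comment> \<open>The values of \<open>g\<close> do not depend on the second coordinate in either part.\<close>
    note sol1 = tensor_block_solution[OF N(1) X, of "\<lambda>r. g (Inl r)", OF eq1 u0]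
    note sol2 = tensor_block_solution[OF N(2) Y, of "\<lambda>r. g (Inr r)", OF eq2 v0]
    have gp: "g (Inl (x, u)) = p x" if "x \<in> N" "u \<in> X" for x u
      using sol1(2) that by (simp add: p_def)
    have gq: "g (Inr (x, v)) = q x" if "x \<in> N" "v \<in> Y" for x v
      using sol2(2) that by (simp add: q_def)
    have Ap: "(\<Sum>y\<in>A `` {x}. p y) = - (real (card Y) / \<mu>) * q x" if "x \<in> N" for x
      using sol1(1)[OF _ _ that] that by (simp add: p_def gq)
    have Bq: "(\<Sum>y\<in>B `` {x}. q y) = - (real (card X) / \<tau>) * p x" if "x \<in> N" for x
      using sol2(1)[OF _ _ that] that by (simp add: q_def gp)
    have BAp: "(\<Sum>y\<in>B `` {x}. \<Sum>z\<in>A `` {y}. p z) = real (a * b) * p x"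
      if x: "x \<in> N" for x
    proof -
      have "(\<Sum>y\<in>B `` {x}. \<Sum>z\<in>A `` {y}. p z) = (\<Sum>y\<in>B `` {x}. - (real (card Y) / \<mu>) * q y)"
        using Ap block_nbrs_subset[OF N(2), of x] by (intro sum.cong) auto
      also have "\<dots> = real (card X) * real (card Y) / (\<mu> * \<tau>) * p x"
        unfolding sum_distrib_left[symmetric] Bq[OF x] by simp
      also have "\<dots> = real (a * b) * p x"
        using pos by (simp add: bal'[symmetric] field_simps)
      finally show ?thesis .
    qed
    have p_const: "p x = p y" if "x \<in> N" "y \<in> N" for x y
      by (rule harm[OF BAp that])
    obtain x0 where x0: "x0 \<in> N" using ne by blast
    define c where "c = p x0 / real (card Y)"
    have "g (Inl (x, u)) = c * w (Inl (x, u))" if "x \<in> N" "u \<in> X" for x u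
      using gp[OF that] p_const[OF that(1) x0] pos by (simp add: c_def w_def)
    moreover have "g (Inr (x, v)) = c * w (Inr (x, v))" if x: "x \<in> N" and v: "v \<in> Y" for x v
    proof -
      have "(\<Sum>y\<in>A `` {x}. p y) = (\<Sum>y\<in>A `` {x}. p x0)"
        using block_nbrs_subset[OF N(1), of x] by (intro sum.cong refl p_const[OF _ x0]) blast
      also have "\<dots> = real a * p x0" using block_degree[OF N(1) x] by simp
      finally show ?thesis
        using Ap[OF x] gq[OF x v] pos by (simp add: c_def w_def field_simps)
    qed
    ultimately show "\<exists>c. \<forall>v\<in>V. g v = c * w v"
      by (intro exI[of _ c]) (auto simp: V_def V1_def V2_def)
  next
    assume "\<exists>c. \<forall>v\<in>V. g v = c * w v"
    then obtain c where c: "\<And>v. v \<in> V \<Longrightarrow> g v = c * w v" by blast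
    have g1: "g (Inl (x, u)) = c * real (card Y)" if "x \<in> N" "u \<in> X" for x u
      using c that by (simp add: V_def V1_def w_def)
    have g2: "g (Inr (x, v)) = - c * real (a * \<mu>)" if "x \<in> N" "v \<in> Y" for x v
      using c that by (simp add: V_def V2_def w_def)
    show "\<forall>u\<in>V. (\<Sum>v\<in>E `` {u}. g v) = 0"
    proof
      fix r assume "r \<in> V"
      then consider x u where "r = Inl (x, u)" "x \<in> N" "u \<in> X"
        | x v where "r = Inr (x, v)" "x \<in> N" "v \<in> Y"
        by (auto simp: V_def V1_def V2_def)
      then show "(\<Sum>v\<in>E `` {r}. g v) = 0"
      proof cases
        case 1
        have "(\<Sum>s\<in>tensor A M `` {(x, u)}. g (Inl s))
            = (\<Sum>s\<in>tensor A M `` {(x, u)}. c * real (card Y))"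
          using g1 block_nbrs_subset[OF AM, of "(x, u)"] by (intro sum.cong) auto
        then show ?thesis
          using 1 sum1[OF 1(2,3), of g] block_degree[OF AM, of "(x, u)"] by (simp add: g2)
      next
        case 2
        have "(\<Sum>s\<in>tensor B T `` {(x, v)}. g (Inr s))
            = (\<Sum>s\<in>tensor B T `` {(x, v)}. - c * real (a * \<mu>))"
          using g2 block_nbrs_subset[OF BT, of "(x, v)"] by (intro sum.cong) auto
        then have "(\<Sum>v\<in>E `` {r}. g v)
            = - c * (real a * real b * real \<mu> * real \<tau>) + c * (real (card X) * real (card Y))"
          using 2 sum2[OF 2(2,3), of g] block_degree[OF BT, of "(x, v)"] by (simp add: g1 mult_ac)
        then show ?thesis by (simp add: bal')
      qed
    qed
  qed
  have "card V = card N * (card X + card Y)"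
    unfolding V_def V1_def V2_def using finite
    by (subst card_Un_disjoint) (auto simp: card_image card_cartesian_product algebra_simps)
  moreover have "\<exists>G :: nat pair_pre_digraph. nut_graph G \<and> num_vertex_orbits G = 2 \<and>
           num_edge_orbits G = 3 \<and> card (pverts G) = card V"
  proof (rule nut_graph_of_relation[OF V_def E_def _ S1V _ _ _ S2V _ _ _ _ _ tr1 tr2 trJ deg1 deg2 deg _ ker])
    show "finite V" using finite by (simp add: V_def V1_def V2_def)
    show "S1 \<noteq> {}" "S2 \<noteq> {}"
      using ne block_nbr_exists[OF AM] block_nbr_exists[OF BT]
      unfolding S1_def S2_def by (metis SigmaI all_not_in_conv empty_iff image_is_empty)+
    show "sym S1" "sym S2"
      using block_sym[OF AM] block_sym[OF BT] by (auto simp: S1_def S2_def sym_def)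
    show "irrefl S1" "irrefl S2" using irr by (auto simp: S1_def S2_def irrefl_def tensor_def)
    show "Domain J = V1" "Range J = V2" using ne by (auto simp: J_def V1_def V2_def)
    show "w v \<noteq> 0" if "v \<in> V" for v
      using that pos by (auto simp: V_def V1_def V2_def w_def)
  qed
  ultimately show ?thesis by simp
qed

section \<open>The cyclic base of prime order\<close>

text \<open>
  Two applications of the equality case for averages, along \<open>B\<close> and then along \<open>A\<close>.
\<close>

lemma maximum_propagates:
  fixes p :: "'a \<Rightarrow> real"
  assumes A: "block N A a" and B: "block N B b"
    and harm: "(\<Sum>y\<in>B `` {x}. \<Sum>z\<in>A `` {y}. p z) = real (a * b) * p x"
    and max: "\<And>y. y \<in> N \<Longrightarrow> p y \<le> p x"
    and x: "x \<in> N" and xy: "(x, y) \<in> B" and yz: "(y, z) \<in> A"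
  shows "p z = p x"
proof -
  have "(\<Sum>z\<in>A `` {y}. p z) = real a * p x"
  proof (rule sum_block_maximum[OF B _ _ x xy])
    fix y assume y: "y \<in> N"
    have "(\<Sum>z\<in>A `` {y}. p z) \<le> real (card (A `` {y})) * p x"
      using max block_nbrs_subset[OF A, of y] by (intro sum_bounded_above) auto
    then show "(\<Sum>z\<in>A `` {y}. p z) \<le> real a * p x" by (simp add: block_degree[OF A y])
  qed (simp add: harm mult_ac)
  then show ?thesis
    using block_subset[OF B] xy by (intro sum_block_maximum[OF A max _ _ yz]) auto
qed

lemma mod_translation_orbit:
  fixes p :: "int \<Rightarrow> 'b"
  assumes cop: "coprime \<sigma> (int n)" and n: "n > 0" and x: "x \<in> {0..<int n}" and px: "p x = m"
    and step: "\<And>y. y \<in> {0..<int n} \<Longrightarrow> p y = m \<Longrightarrow> p ((y + \<sigma>) mod int n) = m"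
    and y: "y \<in> {0..<int n}"
  shows "p y = m"
proof -
  have iter: "p ((x + int k * \<sigma>) mod int n) = m" for k
  proof (induction k)
    case 0
    then show ?case using x px by simp
  next
    case (Suc k)
    have "(x + int (Suc k) * \<sigma>) mod int n = ((x + int k * \<sigma>) mod int n + \<sigma>) mod int n"
      by (simp add: mod_simps algebra_simps)
    then show ?case using step[OF _ Suc] n by simp
  qed
  obtain r where r: "[\<sigma> * r = 1] (mod int n)" using cong_solve_coprime_int[OF cop] by blast
  define k where "k = nat ((r * (y - x)) mod int n)"
  have "[int k * \<sigma> = r * (y - x) * \<sigma>] (mod int n)"
    using n by (intro cong_mult cong_refl) (simp add: k_def)
  also have "r * (y - x) * \<sigma> = (\<sigma> * r) * (y - x)" by simp
  also have "[(\<sigma> * r) * (y - x) = 1 * (y - x)] (mod int n)" by (intro cong_mult r cong_refl)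
  finally have "[x + int k * \<sigma> = x + (y - x)] (mod int n)" by (intro cong_add cong_refl) simp
  then have "(x + int k * \<sigma>) mod int n = y" using y by (simp add: cong_def)
  with iter[of k] show ?thesis by simp
qed

lemma power_residue_succ:
  assumes "n > 0" "x \<in> {0..<int n}"
  shows "(x, (x + 1) mod int n) \<in> power_residue_rel n a"
  using assms cong_power_1_mod[of "x + 1" n x a] by (simp add: power_residue_rel_def)

text \<open>
  The set where \<open>p\<close> attains its maximum is invariant under the translation by \<open>\<sigma>\<close>, since \<open>1\<close> is a root of
  unity: two steps along \<open>A\<close> give \<open>\<sigma> = 2\<close>, a stationary step and a step along \<open>A\<close> give \<open>\<sigma> = 1\<close>. In both
  cases \<open>\<sigma>\<close> generates \<open>\<int>/n\<close>.
\<close>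

lemma power_residue_harmonic_const:
  fixes p :: "int \<Rightarrow> real"
  assumes n: "prime n" "odd n"
    and A: "A = power_residue_rel n a" "block {0..<int n} A a"
    and B: "B = A \<or> B = Id_on {0..<int n}" "block {0..<int n} B b"
    and harm: "\<And>x. x \<in> {0..<int n} \<Longrightarrow>
      (\<Sum>y\<in>B `` {x}. \<Sum>z\<in>A `` {y}. p z) = real (a * b) * p x"
    and x: "x \<in> {0..<int n}" and y: "y \<in> {0..<int n}"
  shows "p x = p y"
proof -
  let ?N = "{0..<int n}"
  have n0: "n > 0" using prime_gt_0_nat[OF n(1)] .
  define \<sigma> :: int where "\<sigma> = (if B = A then 2 else 1)"
  have cop: "coprime \<sigma> (int n)" using n by (simp add: \<sigma>_def)
  have walk: "\<exists>y. (x, y) \<in> B \<and> (y, (x + \<sigma>) mod int n) \<in> A" if x: "x \<in> ?N" for x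
  proof (cases "B = A")
    case True
    have "((x + 1) mod int n + 1) mod int n = (x + \<sigma>) mod int n"
      using True by (simp add: \<sigma>_def mod_simps add.assoc)
    moreover have "(x + 1) mod int n \<in> ?N" using n0 by simp
    ultimately show ?thesis
      using True power_residue_succ[OF n0 x, of a] power_residue_succ[OF n0, of "(x + 1) mod int n" a]
      by (auto simp: A(1))
  next
    case False
    then have "(x, x) \<in> B" using B(1) x by blast
    then show ?thesis
      using False power_residue_succ[OF n0 x, of a] by (auto simp: \<sigma>_def A(1))
  qed
  obtain x0 where x0: "x0 \<in> ?N" and max: "\<And>y. y \<in> ?N \<Longrightarrow> p y \<le> p x0"
  proof -
    have "finite (p ` ?N)" "p ` ?N \<noteq> {}" using n0 by auto
    then have "Max (p ` ?N) \<in> p ` ?N" "\<And>y. y \<in> ?N \<Longrightarrow> p y \<le> Max (p ` ?N)"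
      by (auto intro: Max_in)
    then show ?thesis using that by (metis imageE)
  qed
  have "p y = p x0" if y: "y \<in> ?N" for y
  proof (rule mod_translation_orbit[OF cop n0 x0 refl _ y])
    fix u assume u: "u \<in> ?N" "p u = p x0"
    obtain v where "(u, v) \<in> B" "(v, (u + \<sigma>) mod int n) \<in> A" using walk[OF u(1)] by blast
    then have "p ((u + \<sigma>) mod int n) = p u"
      using maximum_propagates[OF A(2) B(2) harm[OF u(1)] _ u(1)] max u(2) by simp
    then show "p ((u + \<sigma>) mod int n) = p x0" using u(2) by simp
  qed
  with x y show ?thesis by simp
qed

theorem corollary4p5:
  fixes n m t m\<^sub>0 t\<^sub>0 r\<^sub>1 q\<^sub>1 r\<^sub>2 q\<^sub>2 a \<kappa> :: nat
    and mf mf' tf tf' d d' :: "nat \<Rightarrow> nat"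
  assumes "prime n" and "n \<ge> 3"
    and "m \<ge> 1" and "odd m"
    and "t \<ge> 2" and "even t"
    and "m = m\<^sub>0 * (\<Prod>i=1..r\<^sub>1. mf i) * (\<Prod>i=1..q\<^sub>1. mf' i)"
    and "t = t\<^sub>0 * (\<Prod>i=1..r\<^sub>2. tf i) * (\<Prod>i=1..q\<^sub>2. tf' i)"
    and "m\<^sub>0 \<ge> 1" and "t\<^sub>0 \<ge> 1"
    and "\<forall>i\<in>{1..r\<^sub>1}. prime (mf i) \<and> odd (mf i)"
    and "\<forall>j\<in>{1..r\<^sub>2}. prime (tf j) \<and> odd (tf j)"
    and "\<forall>i\<in>{1..q\<^sub>1}. mf' i \<ge> 2"
    and "\<forall>i\<in>{1..q\<^sub>2}. tf' i \<ge> 2"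
    and "\<forall>i\<in>{1..r\<^sub>1}. even (d i) \<and> d i dvd mf i - 1"
    and "\<forall>j\<in>{1..r\<^sub>2}. even (d' j) \<and> d' j dvd tf j - 1"
    and "even a" and "a dvd n - 1"
    and "\<kappa> \<in> {a, a ^ 2}"
    and "\<kappa> * (\<Prod>i=1..r\<^sub>1. d i) * (\<Prod>j=1..r\<^sub>2. d' j)
           * (\<Prod>i=1..q\<^sub>1. mf' i - 1) * (\<Prod>i=1..q\<^sub>2. tf' i - 1) = m * t"
    and "t + a * (\<Prod>i=1..r\<^sub>1. d i) * (\<Prod>i=1..q\<^sub>1. mf' i - 1)
           \<noteq> m + (\<kappa> div a) * (\<Prod>j=1..r\<^sub>2. d' j) * (\<Prod>i=1..q\<^sub>2. tf' i - 1)"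
  shows "\<exists>G :: nat pair_pre_digraph.
           nut_graph G \<and> num_vertex_orbits G = 2 \<and> num_edge_orbits G = 3 \<and>
           card (pverts G) = n * (m + t)"
proof -
  define \<mu> where "\<mu> = (\<Prod>i=1..r\<^sub>1. d i) * (\<Prod>i=1..q\<^sub>1. mf' i - 1)"
  define \<tau> where "\<tau> = (\<Prod>j=1..r\<^sub>2. d' j) * (\<Prod>i=1..q\<^sub>2. tf' i - 1)"
  define b where "b = \<kappa> div a"
  have "realizable (m\<^sub>0 * (\<Prod>i=1..r\<^sub>1. mf i) * (\<Prod>i=1..q\<^sub>1. mf' i))
      (1 * (\<Prod>i=1..r\<^sub>1. d i) * (\<Prod>i=1..q\<^sub>1. mf' i - 1))"
    using assms(11,13,15)
    by (intro realizable_mult realizable_1 realizable_prod realizable_power_residue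
          realizable_complete) auto
  then obtain X :: "nat set" and M where X: "block X M \<mu>" "card X = m"
    using assms(7) unfolding realizable_def \<mu>_def by auto
  have "realizable (t\<^sub>0 * (\<Prod>i=1..r\<^sub>2. tf i) * (\<Prod>i=1..q\<^sub>2. tf' i))
      (1 * (\<Prod>j=1..r\<^sub>2. d' j) * (\<Prod>i=1..q\<^sub>2. tf' i - 1))"
    using assms(12,14,16)
    by (intro realizable_mult realizable_1 realizable_prod realizable_power_residue
          realizable_complete) auto
  then have "realizable t \<tau>" using assms(8) by (simp add: \<tau>_def)
  then obtain Y :: "nat set" and T where Y: "block Y T \<tau>" "card Y = t" "irrefl T"
    using realizable_loopless assms(6) by blast
  let ?N = "{0..<int n}"
  define A where "A = power_residue_rel n a"
  have a0: "a > 0" using assms(2,18) by (auto intro: Nat.gr0I)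
  have A: "block ?N A a"
    unfolding A_def by (rule block_power_residue[OF assms(1) a0 assms(17,18)])
  have b: "b = 1 \<or> b = a" and ab: "a * b = \<kappa>"
    using assms(19) a0 by (auto simp: b_def power2_eq_square)
  obtain B where B: "block ?N B b" "B = A \<or> B = Id_on ?N"
    using b A block_Id[of ?N] by auto
  have "relation_aut ?N A \<subseteq> relation_aut ?N (Id_on ?N)"
    by (auto simp: relation_aut_def bij_betw_def inj_on_def)
  moreover have "arc_transitive ?N A (Id_on ?N)"
    unfolding arc_transitive_def using block_vertex_transitive[OF A] by (metis Id_onE prod.inject)
  ultimately have AB: "relation_aut ?N A \<subseteq> relation_aut ?N B" "arc_transitive ?N A B"
    using B(2) block_arc_transitive[OF A] by auto
  have "\<exists>G :: nat pair_pre_digraph. nut_graph G \<and> num_vertex_orbits G = 2 \<and>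
      num_edge_orbits G = 3 \<and> card (pverts G) = card ?N * (card X + card Y)"
  proof (rule nut_graph_of_blocks[OF A B(1) _ _ _ _ Y(3) AB _ X(1) Y(1)])
    show "?N \<noteq> {}" "X \<noteq> {}" "Y \<noteq> {}" using assms(2,3,5) X(2) Y(2) by auto
    show "irrefl A" unfolding A_def by (rule irrefl_power_residue[OF assms(1) a0])
    show "a * b * \<mu> * \<tau> = card X * card Y"
      using assms(20) by (simp add: X Y ab \<mu>_def \<tau>_def mult_ac)
    show "card Y + a * \<mu> \<noteq> card X + b * \<tau>"
      using assms(21) by (simp add: X Y \<mu>_def \<tau>_def b_def mult_ac)
    have "odd n" using assms(1,2) prime_odd_nat by auto
    then show "p x = p y"
      if "\<And>x. x \<in> ?N \<Longrightarrow> (\<Sum>y\<in>B `` {x}. \<Sum>z\<in>A `` {y}. p z) = real (a * b) * p x"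
        "x \<in> ?N" "y \<in> ?N" for p x y
      by (rule power_residue_harmonic_const[OF assms(1) _ A_def A B(2,1) that])
  qed
  then show ?thesis by (simp add: X Y)
qed

end
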